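(* Suppose that there exist $2^{\mathfrak c}$ pairwise Rudin–Keisler incomparable selective ultrafilters on $\omega$. Let $\kappa$ be an infinite cardinal with $\kappa\le 2^{\mathfrak c}$. Then there exists a Hausdorff topological group $G$ such that $G^{\kappa}$ is countably pracompact and $G^{\kappa^+}$ is not countably pracompact.
   Context: $\kappa^+$ is the successor cardinal of $\kappa$. A space $X$ is countably pracompact if there is a dense set $D\subseteq X$ such that every infinite subset of $D$ has an accumulation point in $X$. Selective ultrafilter: a free ultrafilter $p$ on $\omega$ such that for every partition $\{A_n\}$ of $\omega$ either some $A_n\in p$ or some $B\in p$ meets each $A_n$ in exactly one point. Rudin–Keisler: $p\le_{RK}q$ iff $p=\{A:f^{-1}(A)\in q\}$ for some $f:\omega\to\omega$; incomparable means neither $p\le_{RK}q$ nor $q\le_{RK}p$. Powers carry the product topology. *)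

theory Defs
  imports "HOL-Analysis.Analysis" "HOL-Algebra.Group"
begin

definition free_ultrafilter :: "nat set set \<Rightarrow> bool" where
  "free_ultrafilter p \<longleftrightarrow>
     UNIV \<in> p \<and> {} \<notin> p \<and>
     (\<forall>A B. A \<in> p \<and> A \<subseteq> B \<longrightarrow> B \<in> p) \<and>
     (\<forall>A B. A \<in> p \<and> B \<in> p \<longrightarrow> A \<inter> B \<in> p) \<and>
     (\<forall>A. A \<in> p \<or> - A \<in> p) \<and>
     (\<forall>A. finite A \<longrightarrow> A \<notin> p)"

definition selective_ultrafilter :: "nat set set \<Rightarrow> bool" where
  "selective_ultrafilter p \<longleftrightarrow> free_ultrafilter p \<and>
     (\<forall>A :: nat \<Rightarrow> nat set.
        (\<forall>n. A n \<noteq> {}) \<and> (\<forall>m n. m \<noteq> n \<longrightarrow> A m \<inter> A n = {}) \<and> (\<Union>n. A n) = UNIV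
        \<longrightarrow> (\<exists>n. A n \<in> p) \<or> (\<exists>B\<in>p. \<forall>n. card (B \<inter> A n) = 1 \<and> finite (B \<inter> A n)))"

definition RK_le :: "nat set set \<Rightarrow> nat set set \<Rightarrow> bool" where
  "RK_le p q \<longleftrightarrow> (\<exists>f :: nat \<Rightarrow> nat. p = {A. f -` A \<in> q})"

definition RK_incomparable :: "nat set set \<Rightarrow> nat set set \<Rightarrow> bool" where
  "RK_incomparable p q \<longleftrightarrow> \<not> RK_le p q \<and> \<not> RK_le q p"

definition countably_pracompact :: "'a topology \<Rightarrow> bool" where
  "countably_pracompact X \<longleftrightarrow>
     (\<exists>D. D \<subseteq> topspace X \<and> X closure_of D = topspace X \<and>
          (\<forall>A. A \<subseteq> D \<and> infinite A \<longrightarrow> X derived_set_of A \<noteq> {}))"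

definition topological_group :: "('g, 'b) monoid_scheme \<Rightarrow> 'g topology \<Rightarrow> bool" where
  "topological_group G T \<longleftrightarrow> group G \<and> topspace T = carrier G \<and>
     continuous_map (prod_topology T T) T (\<lambda>(x, y). x \<otimes>\<^bsub>G\<^esub> y) \<and>
     continuous_map T T (\<lambda>x. inv\<^bsub>G\<^esub> x)"

end

theory Submission
  imports Defs
begin

text \<open>
  Proof idea. Let \<open>D\<close> have size \<open>2\<^sup>c\<close> and assign to each injective sequence \<open>s\<close> in \<open>D\<close> its own
  ultrafilter \<open>p s\<close>. The group is generated by points \<open>(d, i)\<close> for \<open>d \<in> D\<close>, \<open>i \<in> K\<close>, together with
  the \<open>p s\<close>-limits of the sequences \<open>(s n, i)\<close>; it is a subgroup of a power of the two-element group,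
  whose coordinates are subsets of \<open>D \<times> K\<close> that are independent enough to make the tuples
  \<open>((d, i))\<^sub>i\<close> dense in the \<open>K\<close>-th power, and rich enough to induce every subset of a countable set
  of points. Each sequence of these tuples has a limit along its ultrafilter, so the \<open>K\<close>-th power is
  countably pracompact.

  Conversely, let \<open>Y\<close> be a set of group elements whose sequences accumulate in the group. Selective
  ultrafilters are P-points, so countably many limit points have disjoint neighbourhoods; this and the
  incomparability of the ultrafilters show that, up to finitely many summands, an element of \<open>Y\<close> has
  the form \<open>\<Sum>i\<in>J. (d, i)\<close>, where \<open>J\<close> lies in a finite set that depends on \<open>Y\<close> only. For a dense subset
  of the \<open>K\<^sup>+\<close>-th power, infinitely many of the coordinate projections have the same finite set, and
  then generic elements have the same \<open>J\<close> but different \<open>d\<close> in two of these coordinates. Two such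
  sequences \<open>d\<close>, \<open>d'\<close> would have to converge along equivalent ultrafilters \<open>p s\<close> and \<open>p s'\<close>, hence
  along the same one, although their ranges are disjoint.
\<close>

section \<open>Ultrafilters\<close>

text \<open>An accumulation point of a sequence yields only a filter of index sets, so convergence
  is stated along proper filters that contain the cofinite sets.\<close>

definition free_filter :: "nat set set \<Rightarrow> bool" where
  "free_filter Q \<longleftrightarrow> {} \<notin> Q \<and> (\<forall>A B. A \<in> Q \<and> A \<subseteq> B \<longrightarrow> B \<in> Q) \<and>
     (\<forall>A B. A \<in> Q \<and> B \<in> Q \<longrightarrow> A \<inter> B \<in> Q) \<and> (\<forall>F. finite F \<longrightarrow> - F \<in> Q)"

lemma free_filterD:
  assumes "free_filter Q"
  shows "{} \<notin> Q" "A \<in> Q \<Longrightarrow> A \<subseteq> B \<Longrightarrow> B \<in> Q" "A \<in> Q \<Longrightarrow> B \<in> Q \<Longrightarrow> A \<inter> B \<in> Q"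
    "finite F \<Longrightarrow> - F \<in> Q"
  using assms unfolding free_filter_def by metis+

lemma free_ultrafilterD:
  assumes "free_ultrafilter p"
  shows "UNIV \<in> p" "{} \<notin> p" "A \<in> p \<Longrightarrow> A \<subseteq> B \<Longrightarrow> B \<in> p" "A \<in> p \<Longrightarrow> B \<in> p \<Longrightarrow> A \<inter> B \<in> p"
    "A \<notin> p \<Longrightarrow> - A \<in> p" "finite F \<Longrightarrow> F \<notin> p"
  using assms unfolding free_ultrafilter_def by metis+

lemma free_ultrafilter_finite_UN:
  assumes "free_ultrafilter p" "finite I"
  shows "(\<Union>i\<in>I. A i) \<in> p \<longleftrightarrow> (\<exists>i\<in>I. A i \<in> p)"
  using assms(2)
proof (induction I)
  case empty
  then show ?case using free_ultrafilterD(2)[OF assms(1)] by simp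
next
  case (insert i I)
  have "A i \<union> B \<in> p \<longleftrightarrow> A i \<in> p \<or> B \<in> p" for B
  proof
    assume "A i \<union> B \<in> p"
    show "A i \<in> p \<or> B \<in> p"
    proof (rule ccontr)
      assume "\<not> ?thesis"
      then have "- A i \<inter> - B \<in> p" using free_ultrafilterD(4,5)[OF assms(1)] by blast
      then have "(- A i \<inter> - B) \<inter> (A i \<union> B) \<in> p"
        using \<open>A i \<union> B \<in> p\<close> free_ultrafilterD(4)[OF assms(1)] by blast
      moreover have "(- A i \<inter> - B) \<inter> (A i \<union> B) = {}" by blast
      ultimately show False using free_ultrafilterD(2)[OF assms(1)] by simp
    qed
  qed (use free_ultrafilterD(3)[OF assms(1)] in blast)
  with insert show ?case by simp
qed

lemma free_ultrafilter_finite_INT: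
  assumes "free_ultrafilter p" "finite I" "\<And>i. i \<in> I \<Longrightarrow> A i \<in> p"
  shows "(\<Inter>i\<in>I. A i) \<in> p"
  using assms(2,3)
  by (induction I) (simp_all add: free_ultrafilterD(1,4)[OF assms(1)])

lemma free_filter_finite_INT:
  assumes "free_filter Q" "finite I" "\<And>i. i \<in> I \<Longrightarrow> A i \<in> Q"
  shows "(\<Inter>i\<in>I. A i) \<in> Q"
  using assms(2,3)
proof (induction I)
  case empty
  then show ?case using free_filterD(4)[OF assms(1), of "{}"] by simp
qed (simp add: free_filterD(3)[OF assms(1)])

text \<open>Selectivity is applied to the partition into the fibres of \<open>f\<close>: a fibre in
  \<open>p\<close> makes \<open>f\<close> constant, a selector makes it injective. If the range is
  finite, one of the finitely many fibres is in \<open>p\<close>.\<close>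

lemma selective_const_or_inj:
  fixes f :: "nat \<Rightarrow> nat"
  assumes "selective_ultrafilter p"
  shows "(\<exists>N\<in>p. \<exists>y. \<forall>k\<in>N. f k = y) \<or> (\<exists>N\<in>p. inj_on f N)"
proof -
  have p: "free_ultrafilter p"
    using assms unfolding selective_ultrafilter_def by blast
  show ?thesis
  proof (cases "finite (range f)")
    case True
    have "(\<Union>y\<in>range f. f -` {y}) \<in> p"
    proof -
      have "(\<Union>y\<in>range f. f -` {y}) = UNIV" by auto
      then show ?thesis using free_ultrafilterD(1)[OF p] by simp
    qed
    then obtain y where "f -` {y} \<in> p"
      using free_ultrafilter_finite_UN[OF p True, of "\<lambda>y. f -` {y}"] by blast
    then show ?thesis by (intro disjI1 bexI[of _ "f -` {y}"] exI[of _ y]) auto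
  next
    case False
    define e where "e = enumerate (range f)"
    have e: "bij_betw e UNIV (range f)"
      unfolding e_def by (rule bij_enumerate[OF False])
    define A where "A n = f -` {e n}" for n
    have "\<forall>n. A n \<noteq> {}"
      using e unfolding A_def bij_betw_def by (metis image_iff rangeI vimage_singleton_eq empty_iff)
    moreover have "\<forall>m n. m \<noteq> n \<longrightarrow> A m \<inter> A n = {}"
      using e unfolding A_def bij_betw_def inj_on_def by auto
    moreover have "(\<Union>n. A n) = UNIV"
      using e unfolding A_def bij_betw_def by (auto simp: image_iff set_eq_iff)
    ultimately have "(\<exists>n. A n \<in> p) \<or> (\<exists>B\<in>p. \<forall>n. card (B \<inter> A n) = 1 \<and> finite (B \<inter> A n))"
      using assms unfolding selective_ultrafilter_def by blast
    then show ?thesis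
    proof
      assume "\<exists>n. A n \<in> p"
      then obtain n where "A n \<in> p" ..
      then show ?thesis by (intro disjI1 bexI[of _ "A n"] exI[of _ "e n"]) (auto simp: A_def)
    next
      assume "\<exists>B\<in>p. \<forall>n. card (B \<inter> A n) = 1 \<and> finite (B \<inter> A n)"
      then obtain B where B: "B \<in> p" "\<And>n. card (B \<inter> A n) = 1" by blast
      have "inj_on f B"
      proof (rule inj_onI)
        fix x y assume xy: "x \<in> B" "y \<in> B" "f x = f y"
        obtain n where "f x = e n" using e unfolding bij_betw_def by (metis imageE rangeI)
        then have "x \<in> B \<inter> A n" "y \<in> B \<inter> A n" using xy by (auto simp: A_def)
        then show "x = y" using B(2)[of n] by (metis card_1_singletonE singletonD)
      qed
      then show ?thesis using B by blast
    qed
  qed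
qed

text \<open>Selective ultrafilters are P-points. The first \<open>n\<close> with
  \<open>k \<notin> W n\<close> cannot be a constant \<open>y\<close> on a member of
  \<open>p\<close>, which would be disjoint from \<open>W y\<close> within \<open>M\<close>; where
  it depends injectively on \<open>k\<close>, only finitely many \<open>k\<close> lie outside each
  \<open>W n\<close>.\<close>

lemma selective_pseudo_intersection:
  assumes "selective_ultrafilter p" and W: "\<And>n::nat. W n \<in> p"
  shows "\<exists>U\<in>p. \<forall>n. finite (U - W n)"
proof (cases "(\<Inter>n. W n) \<in> p")
  case True
  moreover have "(\<Inter>n. W n) - W m = {}" for m by blast
  ultimately show ?thesis by (metis finite.emptyI)
next
  case False
  have p: "free_ultrafilter p"
    using assms unfolding selective_ultrafilter_def by blast
  define M where "M = - (\<Inter>n. W n)"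
  have M: "M \<in> p" unfolding M_def using False by (rule free_ultrafilterD(5)[OF p])
  \<comment> \<open>On the intersection of all \<open>W n\<close> the value of \<open>LEAST\<close>
    is unspecified; \<open>M\<close> excludes these \<open>k\<close>.\<close>
  define f where "f k = (LEAST n. k \<notin> W n)" for k
  have f: "k \<notin> W (f k)" if "k \<in> M" for k
    using that unfolding f_def M_def by (metis (mono_tags, lifting) Compl_iff INT_iff LeastI)
  have f_le: "f k \<le> n" if "k \<notin> W n" for k n
    using that unfolding f_def by (rule Least_le)
  from selective_const_or_inj[OF assms(1), of f] show ?thesis
  proof
    assume "\<exists>N\<in>p. \<exists>y. \<forall>k\<in>N. f k = y"
    then obtain N y where N: "N \<in> p" "\<And>k. k \<in> N \<Longrightarrow> f k = y" by blast
    have "N \<inter> M \<inter> W y \<in> p" using N M W free_ultrafilterD(4)[OF p] by blast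
    moreover have "N \<inter> M \<inter> W y = {}" using N f by blast
    ultimately show ?thesis using free_ultrafilterD(2)[OF p] by simp
  next
    assume "\<exists>N\<in>p. inj_on f N"
    then obtain N where N: "N \<in> p" "inj_on f N" by blast
    have "finite (N - W n)" for n
    proof (rule inj_on_finite)
      show "inj_on f (N - W n)" using N(2) by (rule inj_on_subset) blast
      show "f ` (N - W n) \<subseteq> {..n}" using f_le by auto
    qed simp
    then show ?thesis using N by blast
  qed
qed

section \<open>Choosing sequences\<close>

text \<open>The recursion carries along the finite data \<open>F\<close> of all terms chosen so far,
  so that every term can be required to bring something new.\<close>

lemma sequence_avoiding_predecessors:
  fixes Y :: "'a set" and F :: "'a \<Rightarrow> 'b set"
  assumes step: "\<And>H. finite H \<Longrightarrow> \<exists>A\<in>Y. R A H" and fin: "\<And>A. A \<in> Y \<Longrightarrow> finite (F A)"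
  shows "\<exists>A :: nat \<Rightarrow> 'a. \<forall>n. A n \<in> Y \<and> R (A n) (\<Union>m<n. F (A m))"
proof -
  define P where "P = (\<lambda>(n::nat) (x :: 'b set \<times> 'a). finite (fst x) \<and> snd x \<in> Y \<and> R (snd x) (fst x) \<and> (n = 0 \<longrightarrow> fst x = {}))"
  define T where "T = (\<lambda>(n::nat) (x :: 'b set \<times> 'a) (y :: 'b set \<times> 'a). fst y = fst x \<union> F (snd x))"
  have ex0: "\<exists>x. P 0 x" using step[of "{}"] by (auto simp: P_def)
  have exS: "\<exists>y. P (Suc n) y \<and> T n x y" if x: "P n x" for x n
  proof -
    have "finite (fst x \<union> F (snd x))" using x fin by (auto simp: P_def)
    from step[OF this] obtain A where "A \<in> Y" "R A (fst x \<union> F (snd x))" by blast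
    then show ?thesis using x fin by (intro exI[of _ "(fst x \<union> F (snd x), A)"]) (auto simp: P_def T_def)
  qed
  obtain f where f: "\<And>n. P n (f n)" "\<And>n. T n (f n) (f (Suc n))"
    using dependent_nat_choice[of P T, OF ex0 exS] by blast
  have "fst (f n) = (\<Union>m<n. F (snd (f m)))" for n
  proof (induction n)
    case 0 then show ?case using f(1)[of 0] by (simp add: P_def)
  next
    case (Suc n) then show ?case using f(2)[of n] by (auto simp: T_def lessThan_Suc)
  qed
  then have "snd (f n) \<in> Y \<and> R (snd (f n)) (\<Union>m<n. F (snd (f m)))" for n
    using f(1)[of n] by (simp add: P_def)
  then show ?thesis by (intro exI[of _ "\<lambda>n. snd (f n)"] allI)
qed

text \<open>The parity condition at \<open>n\<close> is met by deciding whether \<open>n\<close> is put into the set, after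
  everything below \<open>n\<close> has been decided.\<close>

lemma triangular_choice:
  fixes g :: "nat set \<Rightarrow> nat \<Rightarrow> bool"
  assumes loc: "\<And>Z n. Z \<subseteq> N \<Longrightarrow> n \<in> N \<Longrightarrow> g Z n = g (Z \<inter> {..n}) n"
    and flip: "\<And>Z n. Z \<subseteq> N \<inter> {..<n} \<Longrightarrow> n \<in> N \<Longrightarrow> g (insert n Z) n \<noteq> g Z n"
  obtains Z where "Z \<subseteq> N" "\<And>n. n \<in> N \<Longrightarrow> g Z n"
proof -
  \<comment> \<open>Stage \<open>n\<close> has decided all numbers below \<open>n\<close>. The
    number \<open>n\<close> is added exactly if the condition at \<open>n\<close> fails without it,
    which \<open>flip\<close> then repairs.\<close>
  define z where
    "z = rec_nat {} (\<lambda>n S. if n \<in> N \<and> \<not> g S n then insert n S else S)"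
  have z0: "z 0 = {}" and zS: "z (Suc n) = (if n \<in> N \<and> \<not> g (z n) n then insert n (z n) else z n)" for n
    by (simp_all add: z_def)
  have sub: "z n \<subseteq> N \<inter> {..<n}" for n
  proof (induction n)
    case (Suc n) then show ?case by (auto simp: zS less_Suc_eq)
  qed (simp add: z0)
  have mono: "z m \<inter> {..<n} = z n" if "n \<le> m" for m n
    using that
  proof (induction m rule: dec_induct)
    case base then show ?case using sub[of n] by blast
  next
    case (step m) then show ?case by (auto simp: zS)
  qed
  define Z where "Z = (\<Union>n. z n)"
  have Z: "Z \<inter> {..n} = z (Suc n)" for n
  proof -
    have "z m \<inter> {..n} \<subseteq> z (Suc n)" for m
    proof (cases "Suc n \<le> m")
      case True
      then show ?thesis using mono[of "Suc n" m] by (simp add: lessThan_Suc_atMost)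
    next
      case False
      then show ?thesis using mono[of m "Suc n"] by (metis Int_lower1 inf.coboundedI1 nat_le_linear)
    qed
    then show ?thesis using sub[of "Suc n"] by (auto simp: Z_def lessThan_Suc_atMost)
  qed
  have "g Z n" if n: "n \<in> N" for n
  proof -
    have "Z \<subseteq> N" using sub by (auto simp: Z_def)
    then have "g Z n = g (z (Suc n)) n" using loc[of Z n] n Z by simp
    also have "\<dots>" using flip[of "z n" n] sub[of n] n by (auto simp: zS)
    finally show ?thesis .
  qed
  moreover have "Z \<subseteq> N" using sub by (auto simp: Z_def)
  ultimately show ?thesis using that by blast
qed

lemma odd_card_insert_flip:
  assumes "finite A" "c \<in> A" "\<And>a. a \<in> A \<Longrightarrow> a \<noteq> c \<Longrightarrow> P a = P' a" "P c \<noteq> P' c"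
  shows "odd (card {a\<in>A. P a}) \<noteq> odd (card {a\<in>A. P' a})"
proof -
  define B where "B = {a\<in>A. a \<noteq> c \<and> P a}"
  have B: "finite B" "c \<notin> B" using assms by (auto simp: B_def)
  have "{a\<in>A. P a} = (if P c then insert c B else B)" using assms by (auto simp: B_def)
  moreover have "{a\<in>A. P' a} = (if P' c then insert c B else B)" using assms by (auto simp: B_def)
  ultimately show ?thesis using B assms(4) by auto
qed

section \<open>Cardinals\<close>

text \<open>Sets of size \<open>Suc n\<close> arise from pairs of an element of \<open>K\<close> and
  a set of size \<open>n\<close>, so by induction no size contributes more than \<open>K\<close> has
  elements; there are countably many sizes.\<close>

lemma card_of_finite_subsets_le:
  assumes inf: "infinite K"
  shows "(card_of {F. finite F \<and> F \<subseteq> K}, card_of K) \<in> ordLeq"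
proof -
  have le: "(card_of {F. finite F \<and> F \<subseteq> K \<and> card F = n}, card_of K) \<in> ordLeq" for n
  proof (induction n)
    case 0
    have "{F. finite F \<and> F \<subseteq> K \<and> card F = 0} = {{}}" by auto
    moreover have "(card_of {{}}, card_of K) \<in> ordLeq"
      using inf by (intro card_of_singl_ordLeq) auto
    ultimately show ?case by (simp only:)
  next
    case (Suc n)
    let ?S = "{F. finite F \<and> F \<subseteq> K \<and> card F = n}"
    have "{F. finite F \<and> F \<subseteq> K \<and> card F = Suc n} \<subseteq> (\<lambda>(a, F). insert a F) ` (K \<times> ?S)"
    proof
      fix F assume F: "F \<in> {F. finite F \<and> F \<subseteq> K \<and> card F = Suc n}"
      then obtain a B where aB: "F = insert a B" "a \<notin> B" "card B = n" by (auto simp: card_Suc_eq)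
      then have "(a, B) \<in> K \<times> ?S" using F by auto
      then show "F \<in> (\<lambda>(a, F). insert a F) ` (K \<times> ?S)" unfolding aB(1) by (rule rev_image_eqI) simp
    qed
    then have "(card_of {F. finite F \<and> F \<subseteq> K \<and> card F = Suc n}, card_of ((\<lambda>(a, F). insert a F) ` (K \<times> ?S))) \<in> ordLeq"
      by (rule card_of_mono1)
    also have "(card_of ((\<lambda>(a, F). insert a F) ` (K \<times> ?S)), card_of (K \<times> ?S)) \<in> ordLeq"
      by (rule card_of_image)
    also have "(card_of (K \<times> ?S), card_of K) \<in> ordLeq"
      using inf by (intro card_of_Times_ordLeq_infinite_Field[OF _ card_of_mono1[OF subset_refl] Suc card_of_Card_order])
        (simp add: Field_card_of)
    finally show ?case .
  qed
  have "(card_of (\<Union>n. {F. finite F \<and> F \<subseteq> K \<and> card F = n}), card_of K) \<in> ordLeq"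
    using inf le by (intro card_of_UNION_ordLeq_infinite) (auto simp: infinite_iff_card_of_nat)
  moreover have "(\<Union>n. {F. finite F \<and> F \<subseteq> K \<and> card F = n}) = {F. finite F \<and> F \<subseteq> K}" by auto
  ultimately show ?thesis by (simp only:)
qed

text \<open>Pigeonhole: \<open>K\<close> has no more finite subsets than elements, so finite fibres
  would bound \<open>L\<close> by \<open>K\<close>.\<close>

lemma infinite_fiber_cardSuc:
  assumes inf: "infinite K" and L: "(card_of L, cardSuc (card_of K)) \<in> ordIso"
    and f: "\<And>x. x \<in> L \<Longrightarrow> finite (f x) \<and> f x \<subseteq> K"
  shows "\<exists>F. infinite {x\<in>L. f x = F}"
proof (rule ccontr)
  assume contra: "\<not> ?thesis"
  have "(card_of {x\<in>L. f x = F}, card_of K) \<in> ordLeq" for F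
    using contra inf by (intro ordLess_imp_ordLeq Cfinite_ordLess_Cinfinite conjI card_of_Card_order)
      (auto simp: cfinite_def cinfinite_def Field_card_of)
  then have "(card_of (\<Union>F\<in>{F. finite F \<and> F \<subseteq> K}. {x\<in>L. f x = F}), card_of K) \<in> ordLeq"
    using inf card_of_finite_subsets_le[OF inf] by (intro card_of_UNION_ordLeq_infinite) auto
  moreover have "L \<subseteq> (\<Union>F\<in>{F. finite F \<and> F \<subseteq> K}. {x\<in>L. f x = F})"
  proof
    fix x assume "x \<in> L"
    then show "x \<in> (\<Union>F\<in>{F. finite F \<and> F \<subseteq> K}. {x\<in>L. f x = F})"
      using f[of x] by simp
  qed
  ultimately have "(card_of L, card_of K) \<in> ordLeq"
    by (meson card_of_mono1 ordLeq_transitive)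
  moreover have "(card_of K, card_of L) \<in> ordLess"
    using cardSuc_greater[OF card_of_Card_order] L
    by (meson ordIso_symmetric ordLess_ordIso_trans)
  ultimately show False using not_ordLess_ordLeq by blast
qed

section \<open>Formal sums of points and of limit points\<close>

text \<open>A pair \<open>(Inl d, i)\<close> is a point of \<open>UNIV \<times> K\<close>, and \<open>(Inr s, i)\<close> stands for
  the \<open>p s\<close>-limit of the sequence \<open>(s k, i)\<close>. Elements of the group are finite sums of these, and
  \<open>val\<close> lists the characters that define the topology by their supports on the points.\<close>

locale ultrafilter_group =
  fixes p :: "(nat \<Rightarrow> 'd) \<Rightarrow> nat set set"
    and val :: "'f \<Rightarrow> ('d \<times> 'k) set"
    and \<Phi> :: "'f set"
    and K :: "'k set"
  assumes ultra: "free_ultrafilter (p s)"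
    and pseudo: "(\<And>n::nat. W n \<in> p s) \<Longrightarrow> \<exists>U\<in>p s. \<forall>n. finite (U - W n)"
    and incomp: "RK_le (p s) (p t) \<Longrightarrow> s = t"
    and sep: "countable S \<Longrightarrow> \<exists>\<phi>\<in>\<Phi>. val \<phi> \<inter> S = V \<inter> S"
    and indep: "finite C \<Longrightarrow> C \<subseteq> \<Phi> \<times> UNIV \<Longrightarrow> \<exists>d. \<forall>(\<phi>, i)\<in>C. (d, i) \<in> val \<phi> \<longleftrightarrow> (\<phi>, i) \<in> C'"
begin

section \<open>Values of characters at formal points\<close>

text \<open>The support \<open>V\<close> fixes a character on the points; at a formal limit its
  value is the limit along \<open>p s\<close> of the values at \<open>(s k, i)\<close>. Thus each
  formal point acts on supports as an ultrafilter, which the next lemmas record.\<close>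

definition ev :: "('d \<times> 'k) set \<Rightarrow> ('d + (nat \<Rightarrow> 'd)) \<times> 'k \<Rightarrow> bool" where
  "ev V a = (case fst a of Inl d \<Rightarrow> (d, snd a) \<in> V | Inr s \<Rightarrow> {k. (s k, snd a) \<in> V} \<in> p s)"

lemma ev_Inl [simp]: "ev V (Inl d, i) \<longleftrightarrow> (d, i) \<in> V"
  and ev_Inr: "ev V (Inr s, i) \<longleftrightarrow> {k. (s k, i) \<in> V} \<in> p s"
  by (simp_all add: ev_def)

lemma ev_mono: "ev V a \<Longrightarrow> V \<subseteq> V' \<Longrightarrow> ev V' a"
  using free_ultrafilterD(3)[OF ultra]
  by (cases a; cases "fst a") (auto simp: ev_Inr subset_iff)

lemma ev_Int: "ev (V \<inter> V') a \<longleftrightarrow> ev V a \<and> ev V' a"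
proof (cases a)
  case (Pair x i)
  show ?thesis
  proof (cases x)
    case (Inr s)
    have "{k. (s k, i) \<in> V \<inter> V'} = {k. (s k, i) \<in> V} \<inter> {k. (s k, i) \<in> V'}" by auto
    moreover have "A \<inter> B \<in> p s \<longleftrightarrow> A \<in> p s \<and> B \<in> p s" for A B
      using free_ultrafilterD(3,4)[OF ultra] by (metis Int_lower1 Int_lower2)
    ultimately show ?thesis using Pair Inr by (simp only: ev_Inr)
  qed (simp add: Pair)
qed

lemma ev_empty [simp]: "\<not> ev {} a"
  using free_ultrafilterD(2)[OF ultra] by (cases a; cases "fst a") (auto simp: ev_Inr)

lemma ev_compl: "ev (- V) a \<longleftrightarrow> \<not> ev V a"
proof
  show "ev (- V) a \<Longrightarrow> \<not> ev V a" using ev_Int[of V "- V" a] by auto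
  show "\<not> ev V a \<Longrightarrow> ev (- V) a"
    using free_ultrafilterD(5)[OF ultra]
    by (cases a; cases "fst a") (auto simp: ev_Inr Collect_neg_eq)
qed

lemma ev_Un: "ev (V \<union> V') a \<longleftrightarrow> ev V a \<or> ev V' a"
proof -
  have "ev (V \<union> V') a \<longleftrightarrow> \<not> ev (- V \<inter> - V') a"
    using ev_compl[of "V \<union> V'" a] unfolding Compl_Un by simp
  then show ?thesis by (simp add: ev_Int ev_compl)
qed

lemma ev_finite_UN: "finite I \<Longrightarrow> ev (\<Union>i\<in>I. f i) a \<longleftrightarrow> (\<exists>i\<in>I. ev (f i) a)"
  by (induction I rule: finite_induct) (auto simp: ev_Un)

text \<open>An injective \<open>s\<close> meets a finite set at finitely many indices only, and
  \<open>p s\<close> is free.\<close>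

lemma ev_finite_limit:
  assumes "inj s" "finite V"
  shows "\<not> ev V (Inr s, i)"
proof -
  have "finite {k. (s k, i) \<in> V}"
    using finite_vimageI[OF assms(2), of "\<lambda>k. (s k, i)"] assms(1)
    by (auto simp: vimage_def inj_def)
  then show ?thesis using free_ultrafilterD(6)[OF ultra] by (auto simp: ev_Inr)
qed

section \<open>Separating limit points\<close>

text \<open>The hypothesis places \<open>p s\<close> inside the image of \<open>p t\<close> under
  \<open>f\<close>. By maximality of ultrafilters the two are equal, and \<open>incomp\<close>
  applies.\<close>

lemma ultrafilter_image_unique:
  assumes "\<And>U. U \<in> p s \<Longrightarrow> f -` U \<in> p t"
  shows "s = t"
proof (rule incomp)
  have "U \<in> p s" if "f -` U \<in> p t" for U
  proof (rule ccontr)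
    assume "U \<notin> p s"
    then have "f -` (- U) \<in> p t" using assms free_ultrafilterD(5)[OF ultra] by blast
    then have "f -` (- U) \<inter> f -` U \<in> p t" using that free_ultrafilterD(4)[OF ultra] by blast
    moreover have "f -` (- U) \<inter> f -` U = {}" by auto
    ultimately show False using free_ultrafilterD(2)[OF ultra] by simp
  qed
  then show "RK_le (p s) (p t)" using assms by (auto simp: RK_le_def intro!: exI[of _ f])
qed

text \<open>Different coordinates are separated by a slice. Within one coordinate, failure of
  separation would make \<open>p s\<close> the image of \<open>p t\<close> under \<open>t\<close>
  followed by the inverse of \<open>s\<close>.\<close>

lemma limits_separated:
  assumes "inj s" "(Inr s, i) \<noteq> (Inr t, j)"
  shows "\<exists>W. ev W (Inr s, i) \<and> \<not> ev W (Inr t, j)"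
proof (cases "i = j")
  case False
  then have "ev (UNIV \<times> {i}) (Inr s, i) \<and> \<not> ev (UNIV \<times> {i}) (Inr t, j)"
    using free_ultrafilterD(1,2)[OF ultra] by (auto simp: ev_Inr)
  then show ?thesis by blast
next
  case True
  show ?thesis
  proof (rule ccontr)
    assume contra: "\<not> ?thesis"
    have "s = t"
    proof (rule ultrafilter_image_unique)
      fix U assume U: "U \<in> p s"
      have "ev (s ` U \<times> {i}) (Inr s, i)"
        unfolding ev_Inr by (rule free_ultrafilterD(3)[OF ultra U]) auto
      then have "ev (s ` U \<times> {i}) (Inr t, i)" using contra True by blast
      then have "{k. t k \<in> s ` U} \<in> p t" by (simp add: ev_Inr)
      then show "(\<lambda>k. inv_into UNIV s (t k)) -` U \<in> p t"
        by (rule free_ultrafilterD(3)[OF ultra]) (auto simp: inv_f_f[OF assms(1)])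
    qed
    then show False using assms(2) True by simp
  qed
qed

text \<open>The P-point property enters here: the sets that separate \<open>(Inr s, i)\<close> from
  the other members of \<open>C\<close> one at a time have a pseudo-intersection, and its finite
  errors are invisible to limits of injective sequences.\<close>

lemma limit_isolated:
  assumes C: "countable C" "C \<subseteq> Inr ` {s. inj s} \<times> UNIV"
    and s: "inj s"
  shows "\<exists>U. ev U (Inr s, i) \<and> (\<forall>c\<in>C. c \<noteq> (Inr s, i) \<longrightarrow> \<not> ev U c)"
proof (cases "C - {(Inr s, i)} = {}")
  case True
  then have "ev UNIV (Inr s, i) \<and> (\<forall>c\<in>C. c \<noteq> (Inr s, i) \<longrightarrow> \<not> ev UNIV c)"
    using free_ultrafilterD(1)[OF ultra] by (auto simp: ev_Inr)
  then show ?thesis by blast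
next
  case False
  define e where "e = from_nat_into (C - {(Inr s, i)})"
  have e: "range e = C - {(Inr s, i)}"
    unfolding e_def using False C(1) by (intro range_from_nat_into) auto
  have "\<exists>W. ev W (Inr s, i) \<and> \<not> ev W (e n)" for n
  proof -
    have "e n \<in> C - {(Inr s, i)}" using e by auto
    then have "e n \<in> Inr ` {s. inj s} \<times> UNIV" "e n \<noteq> (Inr s, i)" using C(2) by auto
    then obtain t j where "e n = (Inr t, j)" "(Inr s, i) \<noteq> (Inr t, j)" by auto
    then show ?thesis using limits_separated[OF s] by metis
  qed
  then obtain W where W: "\<And>n. ev (W n) (Inr s, i)" "\<And>n. \<not> ev (W n) (e n)" by metis
  obtain U0 where U0: "U0 \<in> p s" "\<And>n. finite (U0 - {k. (s k, i) \<in> W n})"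
    using pseudo[of "\<lambda>n. {k. (s k, i) \<in> W n}" s] W(1) by (auto simp: ev_Inr)
  define U where "U = (\<lambda>k. (s k, i)) ` U0"
  have "ev U (Inr s, i)"
    unfolding ev_Inr U_def by (rule free_ultrafilterD(3)[OF ultra U0(1)]) auto
  moreover have "\<not> ev U c" if "c \<in> C" "c \<noteq> (Inr s, i)" for c
  proof
    assume Uc: "ev U c"
    have "c \<in> range e" unfolding e using that by simp
    then obtain n where n: "c = e n" by (rule rangeE)
    have "c \<in> Inr ` {s. inj s} \<times> UNIV" using C(2) that(1) by (rule subsetD)
    then obtain t j where tj: "c = (Inr t, j)" "inj t" by auto
    have "ev (U - W n) c"
      using Uc W(2)[of n] n by (simp add: Diff_eq ev_Int ev_compl)
    moreover have "U - W n \<subseteq> (\<lambda>k. (s k, i)) ` (U0 - {k. (s k, i) \<in> W n})" by (auto simp: U_def)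
    then have "finite (U - W n)" using U0(2) by (meson finite_imageI finite_subset)
    ultimately show False using ev_finite_limit tj by blast
  qed
  ultimately show ?thesis by blast
qed

text \<open>Isolating sets are made disjoint along an enumeration of \<open>C\<close>: removing the
  sets of the finitely many earlier limits from \<open>U c\<close> does not lose
  \<open>c\<close>.\<close>

lemma limits_discrete:
  assumes C: "countable C" "C \<subseteq> Inr ` {s. inj s} \<times> UNIV"
  obtains W where "\<And>c. c \<in> C \<Longrightarrow> ev (W c) c"
    "\<And>c c'. c \<in> C \<Longrightarrow> c' \<in> C \<Longrightarrow> c \<noteq> c' \<Longrightarrow> W c \<inter> W c' = {}"
proof -
  have "\<forall>c\<in>C. \<exists>U. ev U c \<and> (\<forall>c'\<in>C. c' \<noteq> c \<longrightarrow> \<not> ev U c')"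
  proof
    fix c assume "c \<in> C"
    then have "c \<in> Inr ` {s. inj s} \<times> UNIV" using C(2) by (rule subsetD[rotated])
    then obtain s i where "c = (Inr s, i)" "inj s" by auto
    then show "\<exists>U. ev U c \<and> (\<forall>c'\<in>C. c' \<noteq> c \<longrightarrow> \<not> ev U c')"
      using limit_isolated[OF C, of s i] by simp
  qed
  then obtain U where U: "\<And>c. c \<in> C \<Longrightarrow> ev (U c) c"
    "\<And>c c'. c \<in> C \<Longrightarrow> c' \<in> C \<Longrightarrow> c' \<noteq> c \<Longrightarrow> \<not> ev (U c) c'"
    by metis
  define L where "L c = {c'\<in>C. to_nat_on C c' < to_nat_on C c}" for c
  have L: "finite (L c)" for c
  proof (rule inj_on_finite)
    show "inj_on (to_nat_on C) (L c)"
      using inj_on_to_nat_on[OF C(1)] by (rule inj_on_subset) (auto simp: L_def)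
    show "to_nat_on C ` L c \<subseteq> {..<to_nat_on C c}" by (auto simp: L_def)
  qed simp
  define W where "W c = U c - (\<Union>c'\<in>L c. U c')" for c
  have own: "ev (W c) c" if "c \<in> C" for c
  proof -
    have "\<not> ev (\<Union>c'\<in>L c. U c') c"
      unfolding ev_finite_UN[OF L] using U(2) that by (fastforce simp: L_def)
    then show ?thesis using U(1)[OF that] unfolding W_def Diff_eq ev_Int ev_compl by blast
  qed
  have "W c \<inter> W c' = {}" if "c \<in> C" "c' \<in> C" "c \<noteq> c'" for c c'
  proof -
    have "to_nat_on C c \<noteq> to_nat_on C c'"
      using that inj_on_to_nat_on[OF C(1)] by (auto simp: inj_on_def)
    then have "c \<in> L c' \<or> c' \<in> L c" using that by (auto simp: L_def)
    then show ?thesis by (auto simp: W_def)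
  qed
  with own show ?thesis by (rule that)
qed

section \<open>Formal sums and their convergence\<close>

text \<open>A finite set stands for the sum of its elements over the two-element field; this is the
  value there of the additive extension of the character with support \<open>V\<close>.\<close>

definition par :: "('d \<times> 'k) set \<Rightarrow> (('d + (nat \<Rightarrow> 'd)) \<times> 'k) set \<Rightarrow> bool" where
  "par V A = odd (card {a\<in>A. ev V a})"

definition E :: "(('d + (nat \<Rightarrow> 'd)) \<times> 'k) set" where
  "E = (range Inl \<union> Inr ` {s. inj s}) \<times> K"

text \<open>Convergence along \<open>Q\<close> in the topology of pointwise convergence on
  \<open>\<Phi>\<close>, stated for formal sums instead of the group elements that they
  represent.\<close>

definition conv :: "nat set set \<Rightarrow> (nat \<Rightarrow> (('d + (nat \<Rightarrow> 'd)) \<times> 'k) set) \<Rightarrow> (('d + (nat \<Rightarrow> 'd)) \<times> 'k) set \<Rightarrow> bool" where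
  "conv Q A B \<longleftrightarrow> (\<forall>\<phi>\<in>\<Phi>. {n. par (val \<phi>) (A n) = par (val \<phi>) B} \<in> Q)"

definition limits :: "(('d + (nat \<Rightarrow> 'd)) \<times> 'k) set" where
  "limits = range Inr \<times> UNIV"

lemma E_limits: "c \<in> E \<Longrightarrow> c \<in> limits \<Longrightarrow> \<exists>s i. c = (Inr s, i) \<and> inj s"
  by (auto simp: E_def limits_def)

lemma par_cong: "(\<And>a. a \<in> A \<Longrightarrow> ev V a = ev V' a) \<Longrightarrow> par V A = par V' A"
  unfolding par_def by (metis (mono_tags, lifting) Collect_cong)

lemma par_none: "(\<And>a. a \<in> A \<Longrightarrow> \<not> ev V a) \<Longrightarrow> \<not> par V A"
proof -
  assume "\<And>a. a \<in> A \<Longrightarrow> \<not> ev V a"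
  then have "{a\<in>A. ev V a} = {}" by blast
  then show ?thesis by (simp only: par_def card.empty even_zero not_not)
qed

text \<open>The values on countably many finite sums depend on countably many points only, so by
  \<open>sep\<close> an arbitrary \<open>V\<close> can be replaced by a support from the family. Any
  set of points may therefore be used to refute convergence.\<close>

lemma not_conv_if_separated:
  assumes Q: "free_filter Q" and cv: "conv Q A B" and N: "N \<in> Q"
    and fin: "\<And>n. finite (A n)" "finite B"
    and V: "\<And>n. n \<in> N \<Longrightarrow> par V (A n)" "\<not> par V B"
  shows False
proof -
  \<comment> \<open>The countable set of points that determines \<open>ev V a\<close>.\<close>
  define relevant where "relevant a = (case fst a of Inl d \<Rightarrow> {(d, snd a)} | Inr s \<Rightarrow> range (\<lambda>k. (s k, snd a)))"
    for a :: "('d + (nat \<Rightarrow> 'd)) \<times> 'k"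
  have rel: "countable (relevant a)" for a
    by (auto simp: relevant_def split: sum.split)
  define S where "S = (\<Union>a\<in>(\<Union>n. A n) \<union> B. relevant a)"
  have "countable S"
    unfolding S_def using fin rel by (intro countable_UN countable_Un countableI_type) (auto intro: countable_finite)
  then obtain \<phi> where \<phi>: "\<phi> \<in> \<Phi>" "val \<phi> \<inter> S = V \<inter> S" using sep by blast
  have eq: "ev (val \<phi>) a = ev V a" if "relevant a \<subseteq> S" for a
  proof (cases a)
    case (Pair x i)
    show ?thesis
    proof (cases x)
      case (Inl d)
      then show ?thesis using that \<phi>(2) Pair by (auto simp: relevant_def)
    next
      case (Inr s)
      then have "(s k, i) \<in> val \<phi> \<longleftrightarrow> (s k, i) \<in> V" for k
        using that \<phi>(2) Pair by (auto simp: relevant_def)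
      then show ?thesis using Inr Pair by (simp add: ev_Inr)
    qed
  qed
  have A: "par (val \<phi>) (A n) = par V (A n)" for n
    by (intro par_cong eq) (auto simp: S_def)
  have B: "par (val \<phi>) B = par V B"
    by (intro par_cong eq) (auto simp: S_def)
  have "{n. par (val \<phi>) (A n) = par (val \<phi>) B} \<inter> N \<in> Q"
    using cv \<phi>(1) N free_filterD(3)[OF Q] by (auto simp: conv_def)
  moreover have "{n. par (val \<phi>) (A n) = par (val \<phi>) B} \<inter> N = {}"
    using A B V by auto
  ultimately show False using free_filterD(1)[OF Q] by simp
qed

text \<open>The set \<open>V n\<close> switches the value at \<open>c n\<close>. The value on
  \<open>A n\<close> depends on decisions up to \<open>n\<close> only and is flipped by including
  \<open>n\<close>, so \<open>triangular_choice\<close> gives a union of sets \<open>V k\<close>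
  that is odd on all \<open>A n\<close> with \<open>n \<in> N\<close>, while it vanishes on
  \<open>B\<close>.\<close>

lemma triangular_contradiction:
  assumes Q: "free_filter Q" and cv: "conv Q A B" and N: "N \<in> Q"
    and fin: "\<And>n. finite (A n)" "finite B"
    and loc: "\<And>Z n a. Z \<subseteq> N \<Longrightarrow> n \<in> N \<Longrightarrow> a \<in> A n \<Longrightarrow> ev (\<Union>k\<in>Z. V k) a = ev (\<Union>k\<in>Z \<inter> {..n}. V k) a"
    and c: "\<And>n. n \<in> N \<Longrightarrow> c n \<in> A n" "\<And>n. n \<in> N \<Longrightarrow> ev (V n) (c n)"
    and c': "\<And>Z n. Z \<subseteq> N \<inter> {..<n} \<Longrightarrow> n \<in> N \<Longrightarrow> \<not> ev (\<Union>k\<in>Z. V k) (c n)"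
    and other: "\<And>n a. n \<in> N \<Longrightarrow> a \<in> A n \<Longrightarrow> a \<noteq> c n \<Longrightarrow> \<not> ev (V n) a"
    and B: "\<And>b. b \<in> B \<Longrightarrow> \<not> ev (\<Union>k\<in>N. V k) b"
  shows False
proof -
  obtain Z where Z: "Z \<subseteq> N" "\<And>n. n \<in> N \<Longrightarrow> par (\<Union>k\<in>Z. V k) (A n)"
  proof (rule triangular_choice[where N = N and g = "\<lambda>Z n. par (\<Union>k\<in>Z. V k) (A n)"])
    show "par (\<Union>k\<in>Z. V k) (A n) = par (\<Union>k\<in>Z \<inter> {..n}. V k) (A n)"
      if "Z \<subseteq> N" "n \<in> N" for Z n
      using loc[OF that] by (rule par_cong)
    show "par (\<Union>k\<in>insert n Z. V k) (A n) \<noteq> par (\<Union>k\<in>Z. V k) (A n)"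
      if "Z \<subseteq> N \<inter> {..<n}" "n \<in> N" for Z n
      unfolding par_def
    proof (rule odd_card_insert_flip[OF fin(1) c(1)[OF that(2)]])
      show "ev (\<Union>k\<in>insert n Z. V k) a = ev (\<Union>k\<in>Z. V k) a" if "a \<in> A n" "a \<noteq> c n" for a
        using other[OF \<open>n \<in> N\<close> that] by (simp add: ev_Un)
      show "ev (\<Union>k\<in>insert n Z. V k) (c n) \<noteq> ev (\<Union>k\<in>Z. V k) (c n)"
        using c(2)[OF that(2)] c'[OF that] by (simp add: ev_Un)
    qed
  qed blast
  have "\<not> par (\<Union>k\<in>Z. V k) B"
  proof (rule par_none)
    show "\<not> ev (\<Union>k\<in>Z. V k) b" if "b \<in> B" for b
      using B[OF that] ev_mono[of "\<Union>k\<in>Z. V k" b "\<Union>k\<in>N. V k"] Z(1) by blast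
  qed
  then show False using not_conv_if_separated[OF Q cv N fin Z(2)] by blast
qed

text \<open>Disjoint neighbourhoods of the countably many limits involved serve as switches: the one
  at \<open>c n\<close> affects no other limit, and by novelty the later ones affect no limit in
  \<open>A n\<close>.\<close>

lemma not_conv_new_limits:
  assumes Q: "free_filter Q" and cv: "conv Q A B"
    and A: "\<And>n. finite (A n)" "\<And>n. A n \<subseteq> E" and B: "finite B" "B \<subseteq> E"
    and c: "\<And>n. c n \<in> A n \<inter> limits" and new: "\<And>m n. m < n \<Longrightarrow> c n \<notin> A m"
  shows False
proof -
  define C where "C = ((\<Union>n. A n) \<union> B) \<inter> limits"
  have "countable C"
    unfolding C_def using A B
    by (intro countable_Int1 countable_UN countable_Un countableI_type) (auto intro: countable_finite)
  moreover have "C \<subseteq> Inr ` {s. inj s} \<times> UNIV"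
    using A(2) B(2) by (fastforce simp: C_def E_def limits_def)
  ultimately obtain W where W: "\<And>x. x \<in> C \<Longrightarrow> ev (W x) x"
    "\<And>x y. x \<in> C \<Longrightarrow> y \<in> C \<Longrightarrow> x \<noteq> y \<Longrightarrow> W x \<inter> W y = {}"
    using limits_discrete by metis
  define old where "old n = {(d, i). (Inl d, i) \<in> (\<Union>m\<le>n. A m) \<union> B}" for n
  have old: "finite (old n)" for n
  proof -
    have "old n = (\<lambda>(d, i). (Inl d, i)) -` ((\<Union>m\<le>n. A m) \<union> B)" by (auto simp: old_def)
    moreover have "inj (\<lambda>(d, i). (Inl d :: 'd + (nat \<Rightarrow> 'd), i :: 'k))" by (auto simp: inj_def)
    ultimately show ?thesis using A(1) B(1) by (simp add: finite_vimageI)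
  qed
  \<comment> \<open>Removing the finitely many old points makes the values of \<open>V k\<close> on \<open>A n\<close> triangular.\<close>
  define V where "V n = W (c n) - old n" for n
  \<comment> \<open>The \<open>c n\<close> are distinct and \<open>B\<close> is finite, so
    \<open>N\<close> is cofinite.\<close>
  define N where "N = {n. c n \<notin> B}"
  have c_inj: "c m \<noteq> c n" if "m \<noteq> n" for m n
    using c new that by (metis IntE nat_neq_iff)
  then have "finite (c -` B)" using B(1) by (intro finite_vimageI) (auto simp: inj_def)
  then have N: "N \<in> Q"
    using free_filterD(4)[OF Q, of "c -` B"] by (simp add: N_def vimage_def Collect_neg_eq)
  have cC: "c n \<in> C" for n using c by (auto simp: C_def)
  have AC: "a \<in> C" if "a \<in> A n" "a \<in> limits" for a n using that by (auto simp: C_def)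
  have BC: "b \<in> C" if "b \<in> B" "b \<in> limits" for b using that by (auto simp: C_def)
  have lim_or: "(\<exists>d i. a = (Inl d, i)) \<or> a \<in> limits" for a
    by (cases a; cases "fst a") (auto simp: limits_def)
  \<comment> \<open>A limit \<open>a\<close> sees only the part of \<open>X\<close> inside its own
    neighbourhood \<open>W a\<close>.\<close>
  have restrict: "ev X a \<longleftrightarrow> ev (X \<inter> W a) a" if "a \<in> C" for X a
    using W(1)[OF that] by (simp add: ev_Int)
  show False
  proof (rule triangular_contradiction[OF Q cv N A(1) B(1), where V = V and c = c])
    fix Z n a assume Zna: "Z \<subseteq> N" "n \<in> N" "a \<in> A n"
    from lim_or[of a] show "ev (\<Union>k\<in>Z. V k) a = ev (\<Union>k\<in>Z \<inter> {..n}. V k) a"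
    proof
      assume "\<exists>d i. a = (Inl d, i)"
      then obtain d i where a: "a = (Inl d, i)" by blast
      have "(d, i) \<notin> V k" if "\<not> k \<le> n" for k
        using that Zna(3) a by (auto simp: V_def old_def)
      then show ?thesis by (auto simp: a)
    next
      assume "a \<in> limits"
      then have aC: "a \<in> C" using AC Zna by blast
      have "V k \<inter> W a = {}" if "\<not> k \<le> n" for k
      proof -
        have "c k \<noteq> a" using new[of n k] that Zna(3) by auto
        then show ?thesis using W(2)[OF cC aC] by (auto simp: V_def)
      qed
      then have "(\<Union>k\<in>Z. V k) \<inter> W a = (\<Union>k\<in>Z \<inter> {..n}. V k) \<inter> W a" by auto
      then show ?thesis using restrict[OF aC] by metis
    qed
  next
    fix n assume "n \<in> N"
    show "c n \<in> A n" using c by blast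
    obtain s i where "c n = (Inr s, i)" "inj s" using E_limits c A(2) by blast
    then have "\<not> ev (old n) (c n)" using ev_finite_limit old by simp
    then show "ev (V n) (c n)"
      using W(1)[OF cC, of n] unfolding V_def Diff_eq ev_Int ev_compl by blast
  next
    fix Z n assume Z: "Z \<subseteq> N \<inter> {..<n}" "n \<in> N"
    have "V k \<inter> W (c n) = {}" if "k \<in> Z" for k
      using W(2)[OF cC cC c_inj[of k n]] that Z by (auto simp: V_def)
    then have "(\<Union>k\<in>Z. V k) \<inter> W (c n) = {}" by blast
    then show "\<not> ev (\<Union>k\<in>Z. V k) (c n)" using restrict[OF cC] by (metis ev_empty)
  next
    fix n a assume na: "n \<in> N" "a \<in> A n" "a \<noteq> c n"
    from lim_or[of a] show "\<not> ev (V n) a"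
    proof
      assume "\<exists>d i. a = (Inl d, i)"
      then show ?thesis using na by (auto simp: V_def old_def)
    next
      assume "a \<in> limits"
      then have aC: "a \<in> C" using AC na by blast
      then have "V n \<inter> W a = {}" using W(2)[OF cC aC, of n] na by (auto simp: V_def)
      then show ?thesis using restrict[OF aC] by (metis ev_empty)
    qed
  next
    fix b assume b: "b \<in> B"
    from lim_or[of b] show "\<not> ev (\<Union>k\<in>N. V k) b"
    proof
      assume "\<exists>d i. b = (Inl d, i)"
      then show ?thesis using b by (auto simp: V_def old_def)
    next
      assume "b \<in> limits"
      then have bC: "b \<in> C" using BC b by blast
      have "V k \<inter> W b = {}" if "k \<in> N" for k
        using W(2)[OF cC bC, of k] that b by (auto simp: V_def N_def)
      then have "(\<Union>k\<in>N. V k) \<inter> W b = {}" by blast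
      then show ?thesis using restrict[OF bC] by (metis ev_empty)
    qed
  qed
qed

text \<open>Otherwise each limit involved ignores the new points with index in some member of
  \<open>Q\<close>. As there are finitely many limits, one \<open>N\<close> in \<open>Q\<close>
  serves for all of them, and single points act as switches. The conclusion says that
  \<open>p s\<close>, read on the indices of the points, extends \<open>Q\<close>.\<close>

lemma conv_new_points:
  assumes Q: "free_filter Q" and cv: "conv Q A B"
    and A: "\<And>n. finite (A n)" "\<And>n. A n \<subseteq> E" and B: "finite B" "B \<subseteq> E"
    and lim: "finite ((\<Union>n. A n) \<inter> limits)"
    and x: "\<And>n. (Inl (d n), i n) \<in> A n" and new: "\<And>m n. m < n \<Longrightarrow> (Inl (d n), i n) \<notin> A m"
  obtains s j where "inj s" "\<And>N. N \<in> Q \<Longrightarrow> ev ((\<lambda>n. (d n, i n)) ` N) (Inr s, j)"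
proof (rule ccontr)
  assume "\<not> thesis"
  then have contra: "\<And>s j. inj s \<Longrightarrow> \<exists>N\<in>Q. \<not> ev ((\<lambda>n. (d n, i n)) ` N) (Inr s, j)"
    using that by blast
  define C where "C = ((\<Union>n. A n) \<union> B) \<inter> limits"
  have finC: "finite C" using lim B(1) by (simp add: C_def Int_Un_distrib2)
  have "\<exists>N\<in>Q. \<not> ev ((\<lambda>n. (d n, i n)) ` N) c" if "c \<in> C" for c
  proof -
    have "c \<in> E" "c \<in> limits" using that A(2) B(2) unfolding C_def by blast+
    then obtain s j where "c = (Inr s, j)" "inj s" using E_limits by blast
    then show ?thesis using contra by blast
  qed
  then obtain M where M: "\<And>c. c \<in> C \<Longrightarrow> M c \<in> Q" "\<And>c. c \<in> C \<Longrightarrow> \<not> ev ((\<lambda>n. (d n, i n)) ` M c) c"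
    by metis
  have c_inj: "(d m, i m) \<noteq> (d n, i n)" if "m \<noteq> n" for m n
    using x new that by (metis nat_neq_iff prod.inject)
  define N where "N = (\<Inter>c\<in>C. M c) \<inter> - ((\<lambda>n. (Inl (d n), i n)) -` B)"
  have "inj (\<lambda>n. (Inl (d n) :: 'd + (nat \<Rightarrow> 'd), i n))" using c_inj by (auto simp: inj_def)
  then have "finite ((\<lambda>n. (Inl (d n), i n)) -` B)" using B(1) by (rule finite_vimageI[rotated])
  then have N: "N \<in> Q"
    unfolding N_def
    by (intro free_filterD(3)[OF Q] free_filterD(4)[OF Q] free_filter_finite_INT[OF Q finC M(1)])
  have lim_or: "(\<exists>d i. a = (Inl d, i)) \<or> a \<in> limits" for a
    by (cases a; cases "fst a") (auto simp: limits_def)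
  define V where "V n = {(d n, i n)}" for n
  have VZ: "(\<Union>k\<in>Z. V k) = (\<lambda>n. (d n, i n)) ` Z" for Z by (auto simp: V_def)
  have lim_none: "\<not> ev (\<Union>k\<in>Z. V k) c" if "c \<in> C" "Z \<subseteq> N" for c Z
  proof
    assume "ev (\<Union>k\<in>Z. V k) c"
    then have "ev ((\<lambda>n. (d n, i n)) ` M c) c"
      unfolding VZ using that by (elim ev_mono) (auto simp: N_def)
    then show False using M(2) that(1) by blast
  qed
  show False
  proof (rule triangular_contradiction[OF Q cv N A(1) B(1), where V = V and c = "\<lambda>n. (Inl (d n), i n)"])
    fix Z n a assume Zna: "Z \<subseteq> N" "n \<in> N" "a \<in> A n"
    from lim_or[of a] show "ev (\<Union>k\<in>Z. V k) a = ev (\<Union>k\<in>Z \<inter> {..n}. V k) a"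
    proof
      assume "\<exists>d i. a = (Inl d, i)"
      then obtain d' i' where a: "a = (Inl d', i')" by blast
      have "(d', i') \<notin> V k" if "\<not> k \<le> n" for k
        using that Zna(3) a new[of n k] by (auto simp: V_def)
      then show ?thesis by (auto simp: a)
    next
      assume "a \<in> limits"
      then have aC: "a \<in> C" using Zna by (auto simp: C_def)
      have "Z \<inter> {..n} \<subseteq> N" using Zna(1) by blast
      then show ?thesis using lim_none[OF aC Zna(1)] lim_none[OF aC] by blast
    qed
  next
    fix n assume "n \<in> N"
    show "(Inl (d n), i n) \<in> A n" by (rule x)
    show "ev (V n) (Inl (d n), i n)" by (simp add: V_def)
  next
    fix Z n assume Z: "Z \<subseteq> N \<inter> {..<n}" "n \<in> N"
    show "\<not> ev (\<Union>k\<in>Z. V k) (Inl (d n), i n)"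
    proof
      assume "ev (\<Union>k\<in>Z. V k) (Inl (d n), i n)"
      then obtain k where "k \<in> Z" "(d k, i k) = (d n, i n)" unfolding ev_Inl VZ by auto
      then show False using c_inj[of k n] Z by auto
    qed
  next
    fix n a assume na: "n \<in> N" "a \<in> A n" "a \<noteq> (Inl (d n), i n)"
    from lim_or[of a] show "\<not> ev (V n) a"
    proof
      assume "\<exists>d i. a = (Inl d, i)"
      then show ?thesis using na by (auto simp: V_def)
    next
      assume "a \<in> limits"
      then have "a \<in> C" using na by (auto simp: C_def)
      then show ?thesis using lim_none[of a "{n}"] na(1) by simp
    qed
  next
    fix b assume b: "b \<in> B"
    from lim_or[of b] show "\<not> ev (\<Union>k\<in>N. V k) b"
    proof
      assume "\<exists>d i. b = (Inl d, i)"
      then show ?thesis using b by (auto simp: V_def N_def)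
    next
      assume "b \<in> limits"
      then have "b \<in> C" using b by (auto simp: C_def)
      then show ?thesis using lim_none by blast
    qed
  qed
qed

definition dpart :: "(('d + (nat \<Rightarrow> 'd)) \<times> 'k) set \<Rightarrow> 'd set" where
  "dpart A = {d. \<exists>i. (Inl d, i) \<in> A}"

lemma finite_dpart:
  assumes "finite A"
  shows "finite (dpart A)"
proof (rule finite_subset)
  show "dpart A \<subseteq> projl ` fst ` A" by (force simp: dpart_def)
qed (use assms in simp)

text \<open>\<open>conv_new_points\<close> is used twice: for \<open>A\<close> along
  \<open>Q\<close>, then for \<open>A'\<close> along the filter \<open>Q'\<close> that the first
  limit induces on indices. This makes \<open>p s\<close> an image of \<open>p s'\<close>, hence
  \<open>s = s'\<close>; but then one sequence takes values of \<open>d\<close> and values of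
  \<open>d'\<close> on members of the same ultrafilter.\<close>

lemma not_conv_two_point_sequences:
  assumes Q: "free_filter Q" and cv: "conv Q A B" "conv Q A' B'"
    and A: "\<And>n. finite (A n)" "\<And>n. A n \<subseteq> E" and B: "finite B" "B \<subseteq> E"
    and A': "\<And>n. finite (A' n)" "\<And>n. A' n \<subseteq> E" and B': "finite B'" "B' \<subseteq> E"
    and lim: "finite ((\<Union>n. A n) \<inter> limits)" "finite ((\<Union>n. A' n) \<inter> limits)"
    and x: "\<And>n. (Inl (d n), i n) \<in> A n" and new: "\<And>m n. m < n \<Longrightarrow> d n \<notin> dpart (A m)"
    and x': "\<And>n. (Inl (d' n), i' n) \<in> A' n" and new': "\<And>m n. m < n \<Longrightarrow> d' n \<notin> dpart (A' m)"
    and ne: "\<And>m n. d m \<noteq> d' n"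
  shows False
proof -
  let ?im = "\<lambda>N. (\<lambda>n. (d n, i n)) ` N" and ?im' = "\<lambda>N. (\<lambda>n. (d' n, i' n)) ` N"
  have "(Inl (d n), i n) \<notin> A m" if "m < n" for m n
    using new[OF that] by (auto simp: dpart_def)
  then obtain s j where s: "inj s" "\<And>N. N \<in> Q \<Longrightarrow> ev (?im N) (Inr s, j)"
    using conv_new_points[OF Q cv(1) A B lim(1), where d = d and i = i, OF x] by blast
  have "d m \<in> dpart (A m)" "d' m \<in> dpart (A' m)" for m using x x' by (auto simp: dpart_def)
  then have d: "inj d" and d': "inj d'"
    using new new' unfolding inj_def by (metis nat_neq_iff)+
  \<comment> \<open>Passing from \<open>Q\<close> to this larger filter is what ties the second
    limit to the first.\<close>
  define Q' where "Q' = {N. ev (?im N) (Inr s, j)}"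
  have Q': "free_filter Q'"
    unfolding free_filter_def
  proof (intro conjI allI impI)
    show "{} \<notin> Q'" by (simp add: Q'_def)
    show "Y \<in> Q'" if "X \<in> Q' \<and> X \<subseteq> Y" for X Y
      using that ev_mono[of "?im X" "(Inr s, j)" "?im Y"] by (auto simp: Q'_def)
    show "X \<inter> Y \<in> Q'" if "X \<in> Q' \<and> Y \<in> Q'" for X Y
    proof -
      have "?im (X \<inter> Y) = ?im X \<inter> ?im Y" using d by (auto simp: inj_def)
      then show ?thesis using that by (simp add: Q'_def ev_Int)
    qed
    show "- F \<in> Q'" if "finite F" for F
      using s(2) free_filterD(4)[OF Q that] by (simp add: Q'_def)
  qed
  have "conv Q' A' B'" using cv(2) s(2) by (auto simp: conv_def Q'_def)
  moreover have "(Inl (d' n), i' n) \<notin> A' m" if "m < n" for m n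
    using new'[OF that] by (auto simp: dpart_def)
  ultimately obtain s' j' where s': "inj s'" "\<And>N. N \<in> Q' \<Longrightarrow> ev (?im' N) (Inr s', j')"
    using conv_new_points[OF Q' _ A' B' lim(2), where d = d' and i = i', OF _ x'] by blast
  have img: "{k. (s k, j) \<in> ?im UNIV} \<in> p s"
    using s(2)[of UNIV] free_filterD(4)[OF Q, of "{}"] by (simp add: ev_Inr)
  have img': "{k. (s' k, j') \<in> ?im' UNIV} \<in> p s'"
    using s'(2)[of UNIV] free_filterD(4)[OF Q', of "{}"] by (simp add: ev_Inr)
  have "s = s'"
  proof (rule ultrafilter_image_unique)
    fix U assume U: "U \<in> p s"
    define N where "N = {n. \<exists>k\<in>U. s k = d n}"
    have "{k. (s k, j) \<in> ?im N} \<in> p s"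
      by (rule free_ultrafilterD(3)[OF ultra free_ultrafilterD(4)[OF ultra img U]]) (auto simp: N_def)
    then have "N \<in> Q'" by (simp add: Q'_def ev_Inr)
    then have *: "{k. (s' k, j') \<in> ?im' N} \<in> p s'" using s'(2) by (simp add: ev_Inr)
    \<comment> \<open>If \<open>s' k = d' n\<close>, the map sends \<open>k\<close> to the
      \<open>l\<close> with \<open>s l = d n\<close>; the common index \<open>n\<close> is the
      link.\<close>
    show "(\<lambda>k. inv_into UNIV s (d (inv_into UNIV d' (s' k)))) -` U \<in> p s'"
    proof (rule free_ultrafilterD(3)[OF ultra *], rule subsetI)
      fix k assume "k \<in> {k. (s' k, j') \<in> ?im' N}"
      then obtain n where n: "n \<in> N" "s' k = d' n" by auto
      then obtain l where l: "l \<in> U" "d n = s l" by (auto simp: N_def)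
      have "inv_into UNIV s (d (inv_into UNIV d' (s' k))) = l"
        by (simp add: n(2) inv_f_f[OF d'] l(2) inv_f_f[OF s(1)])
      then show "k \<in> (\<lambda>k. inv_into UNIV s (d (inv_into UNIV d' (s' k)))) -` U" using l by simp
    qed
  qed
  then have "{k. (s k, j) \<in> ?im UNIV} \<inter> {k. (s k, j') \<in> ?im' UNIV} \<in> p s"
    using img img' free_ultrafilterD(4)[OF ultra] by blast
  moreover have "{k. (s k, j) \<in> ?im UNIV} \<inter> {k. (s k, j') \<in> ?im' UNIV} = {}"
    by auto (metis ne)
  ultimately show False using free_ultrafilterD(2)[OF ultra] by simp
qed

section \<open>Sets of formal sums whose sequences accumulate\<close>

text \<open>What the accumulation property of a subset of a power leaves in one coordinate;
  \<open>Y\<close> will consist of representatives of the values in that coordinate.\<close>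

definition rel_compact :: "(('d + (nat \<Rightarrow> 'd)) \<times> 'k) set set \<Rightarrow> bool" where
  "rel_compact Y \<longleftrightarrow> (\<forall>A\<in>Y. finite A \<and> A \<subseteq> E) \<and>
     (\<forall>A. inj A \<and> range A \<subseteq> Y \<longrightarrow> (\<exists>Q B. free_filter Q \<and> finite B \<and> B \<subseteq> E \<and> conv Q A B))"

lemma rel_compactD:
  assumes "rel_compact Y" "\<And>n. A n \<in> Y"
  shows "finite (A n)" "A n \<subseteq> E"
    and "(\<And>m n. m < n \<Longrightarrow> c n \<in> A n - A m) \<Longrightarrow>
      \<exists>Q B. free_filter Q \<and> conv Q A B \<and> finite B \<and> B \<subseteq> E"
proof -
  show "finite (A n)" "A n \<subseteq> E" using assms unfolding rel_compact_def by auto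
  assume c: "\<And>m n. m < n \<Longrightarrow> c n \<in> A n - A m"
  have "inj A"
  proof (rule injI)
    fix m n assume "A m = A n"
    then show "m = n" using c[of m n] c[of n m] by (cases m n rule: linorder_cases) auto
  qed
  moreover have "range A \<subseteq> Y" using assms(2) by blast
  ultimately show "\<exists>Q B. free_filter Q \<and> conv Q A B \<and> finite B \<and> B \<subseteq> E"
    using assms(1) unfolding rel_compact_def by metis
qed

text \<open>Infinitely many limits would allow a sequence in \<open>Y\<close> whose terms each bring
  a new one, contrary to \<open>not_conv_new_limits\<close>.\<close>

lemma rel_compact_limits:
  assumes Y: "rel_compact Y"
  shows "finite (\<Union>Y \<inter> limits)"
proof (rule ccontr)
  assume inf: "infinite (\<Union>Y \<inter> limits)"
  have step: "\<exists>A\<in>Y. \<exists>c\<in>limits. c \<in> A - H" if "finite H" for H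
  proof -
    have "infinite (\<Union>Y \<inter> limits - H)" using inf that by simp
    then have "\<Union>Y \<inter> limits - H \<noteq> {}" by (rule infinite_imp_nonempty)
    then show ?thesis by blast
  qed
  have fin: "finite A" if "A \<in> Y" for A using Y that by (auto simp: rel_compact_def)
  obtain A :: "nat \<Rightarrow> (('d + (nat \<Rightarrow> 'd)) \<times> 'k) set" where A0: "\<forall>n. A n \<in> Y \<and> (\<exists>c\<in>limits. c \<in> A n - (\<Union>m<n. A m))"
    using sequence_avoiding_predecessors
      [where R = "\<lambda>A H. \<exists>c\<in>limits. c \<in> A - H" and F = "\<lambda>A. A", OF step fin] ..
  note A = A0[THEN spec, THEN conjunct1] A0[THEN spec, THEN conjunct2]
  obtain c where c0: "\<And>n. c n \<in> limits" "\<And>n. c n \<in> A n - (\<Union>m<n. A m)"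
    using A(2) by metis
  have c: "c n \<in> limits" "c n \<in> A n" "m < n \<Longrightarrow> c n \<notin> A m" for m n
    using c0[of n] by auto
  have "c n \<in> A n - A m" if "m < n" for m n using that c by auto
  from rel_compactD(3)[where A = A and c = "c", OF Y A(1) this]
  obtain Q B where QB0: "free_filter Q" "conv Q A B" "finite B" "B \<subseteq> E" by blast
  note QB = QB0(1,2) rel_compactD(1,2)[where A = A, OF Y A(1)] QB0(3,4)
  show False by (rule not_conv_new_limits[OF QB]) (use c in auto)
qed

text \<open>Otherwise there are new points in pairwise different coordinates. A limit that catches
  them belongs to one coordinate \<open>j\<close>, which contains at most one of these points, so a
  finite set would be large for it.\<close>

lemma rel_compact_coordinates:
  assumes Y: "rel_compact Y"
  shows "finite {i. \<exists>A\<in>Y. \<exists>d. (Inl d, i) \<in> A}"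
proof (rule ccontr)
  assume inf: "infinite {i. \<exists>A\<in>Y. \<exists>d. (Inl d, i) \<in> A}"
  have step: "\<exists>A\<in>Y. \<exists>d i. (Inl d, i) \<in> A \<and> i \<notin> H" if "finite H" for H
  proof -
    have "infinite ({i. \<exists>A\<in>Y. \<exists>d. (Inl d, i) \<in> A} - H)" using inf that by simp
    then have "{i. \<exists>A\<in>Y. \<exists>d. (Inl d, i) \<in> A} - H \<noteq> {}" by (rule infinite_imp_nonempty)
    then show ?thesis by blast
  qed
  have fin: "finite (snd ` A)" if "A \<in> Y" for A using Y that by (auto simp: rel_compact_def)
  obtain A :: "nat \<Rightarrow> (('d + (nat \<Rightarrow> 'd)) \<times> 'k) set" where A0: "\<forall>n. A n \<in> Y \<and> (\<exists>d i. (Inl d, i) \<in> A n \<and> i \<notin> (\<Union>m<n. snd ` A m))"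
    using sequence_avoiding_predecessors
      [where R = "\<lambda>A H. \<exists>d i. (Inl d, i) \<in> A \<and> i \<notin> H" and F = "\<lambda>A. snd ` A", OF step fin] ..
  note A = A0[THEN spec, THEN conjunct1] A0[THEN spec, THEN conjunct2]
  obtain d i where di: "\<And>n. (Inl (d n), i n) \<in> A n" "\<And>n. i n \<notin> (\<Union>m<n. snd ` A m)"
    using A(2) by metis
  have new: "(Inl (d n), i n) \<notin> A m" if "m < n" for m n
    using di(2)[of n] that by force
  have "(Inl (d n), i n) \<in> A n - A m" if "m < n" for m n using that di(1) new by auto
  from rel_compactD(3)[where A = A and c = "\<lambda>n. (Inl (d n), i n)", OF Y A(1) this]
  obtain Q B where QB0: "free_filter Q" "conv Q A B" "finite B" "B \<subseteq> E" by blast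
  note QB = QB0(1,2) rel_compactD(1,2)[where A = A, OF Y A(1)] QB0(3,4)
  have "finite ((\<Union>n. A n) \<inter> limits)"
    by (rule finite_subset[OF _ rel_compact_limits[OF Y]]) (use A(1) in blast)
  then obtain s j where s: "inj s" "\<And>N. N \<in> Q \<Longrightarrow> ev ((\<lambda>n. (d n, i n)) ` N) (Inr s, j)"
    using conv_new_points[OF QB _ di(1) new] by blast
  have "ev ((\<lambda>n. (d n, i n)) ` UNIV \<inter> UNIV \<times> {j}) (Inr s, j)"
    using s(2)[of UNIV] free_filterD(4)[OF QB(1), of "{}"] free_ultrafilterD(1)[OF ultra]
    by (simp add: ev_Int ev_Inr)
  moreover have "i n \<noteq> i m" if "m < n" for m n
    using di(1)[of m] di(2)[of n] that by force
  then have "inj i" unfolding inj_def by (metis nat_neq_iff)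
  then have "finite (i -` {j})" by (simp add: finite_vimageI)
  then have "finite ((\<lambda>n. (d n, i n)) ` (i -` {j}))" by simp
  then have "finite ((\<lambda>n. (d n, i n)) ` UNIV \<inter> UNIV \<times> {j})"
    by (rule finite_subset[rotated]) auto
  ultimately show False using ev_finite_limit[OF s(1)] by blast
qed

text \<open>Otherwise each term of some sequence brings two new first coordinates. They form two
  sequences with disjoint ranges, excluded by \<open>not_conv_two_point_sequences\<close> with the
  same \<open>A\<close> in both roles.\<close>

lemma rel_compact_one_new_point:
  assumes Y: "rel_compact Y"
  shows "\<exists>H. finite H \<and> (\<forall>A\<in>Y. \<forall>d\<in>dpart A - H. \<forall>d'\<in>dpart A - H. d = d')"
proof (rule ccontr)
  assume contra: "\<not> ?thesis"
  have step: "\<exists>A\<in>Y. \<exists>d\<in>dpart A - H. \<exists>d'\<in>dpart A - H. d \<noteq> d'" if "finite H" for H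
    using contra that by metis
  have fin: "finite (dpart A)" if "A \<in> Y" for A
    using Y that by (auto simp: rel_compact_def intro: finite_dpart)
  obtain A :: "nat \<Rightarrow> (('d + (nat \<Rightarrow> 'd)) \<times> 'k) set" where A0: "\<forall>n. A n \<in> Y \<and>
    (\<exists>d\<in>dpart (A n) - (\<Union>m<n. dpart (A m)). \<exists>d'\<in>dpart (A n) - (\<Union>m<n. dpart (A m)). d \<noteq> d')"
    using sequence_avoiding_predecessors
      [where R = "\<lambda>A H. \<exists>d\<in>dpart A - H. \<exists>d'\<in>dpart A - H. d \<noteq> d'" and F = dpart, OF step fin] ..
  note A = A0[THEN spec, THEN conjunct1] A0[THEN spec, THEN conjunct2]
  obtain d d' where d: "\<And>n. d n \<in> dpart (A n) - (\<Union>m<n. dpart (A m))"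
    "\<And>n. d' n \<in> dpart (A n) - (\<Union>m<n. dpart (A m))" "\<And>n. d n \<noteq> d' n"
    using A(2) by metis
  have "\<exists>i. (Inl (d n), i) \<in> A n" "\<exists>i. (Inl (d' n), i) \<in> A n" for n
    using d(1,2)[of n] by (auto simp: dpart_def)
  then obtain i i' where i: "\<And>n. (Inl (d n), i n) \<in> A n" "\<And>n. (Inl (d' n), i' n) \<in> A n"
    by metis
  have new: "d n \<notin> dpart (A m)" "d' n \<notin> dpart (A m)" if "m < n" for m n
    using d(1,2)[of n] that by auto
  have new': "(Inl (d n), i n) \<notin> A m" if "m < n" for m n
    using new(1)[OF that] by (auto simp: dpart_def)
  have "(Inl (d n), i n) \<in> A n - A m" if "m < n" for m n using that i(1) new' by auto
  from rel_compactD(3)[where A = A and c = "\<lambda>n. (Inl (d n), i n)", OF Y A(1) this]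
  obtain Q B where QB0: "free_filter Q" "conv Q A B" "finite B" "B \<subseteq> E" by blast
  note QB = QB0(1,2) rel_compactD(1,2)[where A = A, OF Y A(1)] QB0(3,4)
  have lim: "finite ((\<Union>n. A n) \<inter> limits)"
    by (rule finite_subset[OF _ rel_compact_limits[OF Y]]) (use A(1) in blast)
  have "d m \<noteq> d' n" for m n
    using d(1)[of m] d(2)[of n] d(3)[of n] new(1)[of n m] new(2)[of m n]
    by (cases m n rule: linorder_cases) auto
  then show False
    using not_conv_two_point_sequences[OF QB(1,2,2,3-6,3-6) lim lim i(1) new(1) i(2) new(2)] by blast
qed

section \<open>The group\<close>

text \<open>The image of a formal sum in the power of the two-element group indexed by
  \<open>\<Phi>\<close>, written as the set of characters with value 1. Addition becomes symmetric
  difference.\<close>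

definition gen :: "(('d + (nat \<Rightarrow> 'd)) \<times> 'k) set \<Rightarrow> 'f set" where
  "gen A = {\<phi>\<in>\<Phi>. par (val \<phi>) A}"

definition Gset :: "'f set set" where
  "Gset = gen ` {A. finite A \<and> A \<subseteq> E}"

definition G :: "'f set monoid" where
  "G = \<lparr>carrier = Gset, mult = sym_diff, one = {}\<rparr>"

definition near :: "'f set \<Rightarrow> 'f set \<Rightarrow> 'f set set" where
  "near F g = {h\<in>Gset. h \<inter> F = g \<inter> F}"

text \<open>The subspace topology from this power: basic neighbourhoods prescribe the values of
  finitely many characters.\<close>

definition T :: "'f set topology" where
  "T = topology (\<lambda>U. U \<subseteq> Gset \<and> (\<forall>g\<in>U. \<exists>F. finite F \<and> F \<subseteq> \<Phi> \<and> near F g \<subseteq> U))"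

lemma par_sym_diff:
  assumes "finite A" "finite B"
  shows "par V (sym_diff A B) \<longleftrightarrow> par V A \<noteq> par V B"
proof -
  define X Y where "X = {a\<in>A. ev V a}" and "Y = {a\<in>B. ev V a}"
  have fin: "finite X" "finite Y" using assms by (auto simp: X_def Y_def)
  have "{a \<in> sym_diff A B. ev V a} = (X - Y) \<union> (Y - X)" by (auto simp: X_def Y_def)
  moreover have "card ((X - Y) \<union> (Y - X)) = card (X - Y) + card (Y - X)"
    using fin by (intro card_Un_disjoint) auto
  moreover have "card X = card (X - Y) + card (X \<inter> Y)" "card Y = card (Y - X) + card (X \<inter> Y)"
    using fin by (metis card_Int_Diff add.commute, metis card_Int_Diff add.commute Int_commute)
  ultimately show ?thesis unfolding par_def X_def[symmetric] Y_def[symmetric] by auto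
qed

lemma gen_sym_diff: "finite A \<Longrightarrow> finite B \<Longrightarrow> gen (sym_diff A B) = sym_diff (gen A) (gen B)"
  by (auto simp: gen_def par_sym_diff)

lemma mem_gen_single: "\<phi> \<in> gen {a} \<longleftrightarrow> \<phi> \<in> \<Phi> \<and> ev (val \<phi>) a"
proof -
  have "{x \<in> {a}. ev (val \<phi>) x} = (if ev (val \<phi>) a then {a} else {})" by auto
  then show ?thesis by (simp add: gen_def par_def)
qed

lemma gen_empty: "gen {} = {}"
  by (simp add: gen_def par_def)

lemma Gset_empty: "{} \<in> Gset"
  unfolding Gset_def by (rule image_eqI[of _ _ "{}"]) (simp_all add: gen_empty)

lemma Gset_sub: "g \<in> Gset \<Longrightarrow> g \<subseteq> \<Phi>"
  by (auto simp: Gset_def gen_def)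

lemma Gset_sym_diff:
  assumes "g \<in> Gset" "h \<in> Gset"
  shows "sym_diff g h \<in> Gset"
proof -
  obtain A B where AB: "finite A" "A \<subseteq> E" "g = gen A" "finite B" "B \<subseteq> E" "h = gen B"
    using assms by (auto simp: Gset_def)
  then have "sym_diff g h = gen (sym_diff A B)" by (simp add: gen_sym_diff)
  moreover have "finite (sym_diff A B)" "sym_diff A B \<subseteq> E" using AB by auto
  ultimately show ?thesis unfolding Gset_def by blast
qed

definition rep :: "'f set \<Rightarrow> (('d + (nat \<Rightarrow> 'd)) \<times> 'k) set" where
  "rep g = (SOME A. finite A \<and> A \<subseteq> E \<and> gen A = g)"

lemma rep:
  assumes "g \<in> Gset"
  shows "finite (rep g)" "rep g \<subseteq> E" "gen (rep g) = g"
proof -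
  have "\<exists>A. finite A \<and> A \<subseteq> E \<and> gen A = g" using assms by (auto simp: Gset_def)
  from someI_ex[OF this] show "finite (rep g)" "rep g \<subseteq> E" "gen (rep g) = g"
    unfolding rep_def by blast+
qed

lemma par_rep: "g \<in> Gset \<Longrightarrow> \<phi> \<in> \<Phi> \<Longrightarrow> par (val \<phi>) (rep g) \<longleftrightarrow> \<phi> \<in> g"
  using rep(3)[of g] by (auto simp: gen_def)

lemma openin_T:
  "openin T U \<longleftrightarrow> U \<subseteq> Gset \<and> (\<forall>g\<in>U. \<exists>F. finite F \<and> F \<subseteq> \<Phi> \<and> near F g \<subseteq> U)"
proof -
  let ?N = "\<lambda>U g. \<exists>F. finite F \<and> F \<subseteq> \<Phi> \<and> near F g \<subseteq> U"
  have "istopology (\<lambda>U. U \<subseteq> Gset \<and> (\<forall>g\<in>U. ?N U g))"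
    unfolding istopology_def
  proof (intro conjI allI impI ballI)
    fix S S' assume S: "S \<subseteq> Gset \<and> (\<forall>g\<in>S. ?N S g)" and S': "S' \<subseteq> Gset \<and> (\<forall>g\<in>S'. ?N S' g)"
    show "S \<inter> S' \<subseteq> Gset" using S by (simp add: le_infI1)
    fix g assume g: "g \<in> S \<inter> S'"
    have "?N S g" using S g by simp
    then obtain F where F: "finite F" "F \<subseteq> \<Phi>" "near F g \<subseteq> S" by (elim exE conjE)
    have "?N S' g" using S' g by simp
    then obtain F' where F': "finite F'" "F' \<subseteq> \<Phi>" "near F' g \<subseteq> S'" by (elim exE conjE)
    have "near (F \<union> F') g \<subseteq> near F g" "near (F \<union> F') g \<subseteq> near F' g"
      unfolding near_def by blast+
    then have "near (F \<union> F') g \<subseteq> S \<inter> S'" using F(3) F'(3) by (meson Int_greatest order_trans)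
    then show "?N (S \<inter> S') g"
      using F(1,2) F'(1,2) by (intro exI[of _ "F \<union> F'"]) simp
  next
    fix \<K> assume K: "\<forall>U\<in>\<K>. U \<subseteq> Gset \<and> (\<forall>g\<in>U. ?N U g)"
    show "\<Union>\<K> \<subseteq> Gset" using K by (simp add: Sup_least)
    fix g assume "g \<in> \<Union>\<K>"
    then obtain U where U: "U \<in> \<K>" "g \<in> U" by (rule UnionE)
    have "?N U g" using K U by simp
    then obtain F where "finite F" "F \<subseteq> \<Phi>" "near F g \<subseteq> U" by (elim exE conjE)
    moreover have "U \<subseteq> \<Union>\<K>" using U(1) by (rule Union_upper)
    ultimately show "?N (\<Union>\<K>) g" by (intro exI[of _ F]) (simp add: order_trans[of _ U])
  qed
  then show ?thesis by (simp add: T_def)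
qed

lemma topspace_T [simp]: "topspace T = Gset"
proof
  show "topspace T \<subseteq> Gset" using openin_T[of "topspace T"] by simp
  have "near {} g \<subseteq> Gset" for g by (auto simp: near_def)
  then have "openin T Gset" unfolding openin_T by (auto intro!: exI[of _ "{}"])
  then show "Gset \<subseteq> topspace T" by (rule openin_subset)
qed

lemma openin_near:
  assumes "finite F" "F \<subseteq> \<Phi>"
  shows "openin T (near F g)"
proof -
  have "near F h = near F g" if "h \<in> near F g" for h using that by (auto simp: near_def)
  moreover have "near F g \<subseteq> Gset" by (auto simp: near_def)
  ultimately show ?thesis unfolding openin_T using assms by (intro conjI ballI exI[of _ F]) simp_all
qed

lemma near_self: "g \<in> Gset \<Longrightarrow> g \<in> near F g"
  by (simp add: near_def)

lemma Hausdorff_T: "Hausdorff_space T"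
  unfolding Hausdorff_space_def
proof (intro allI impI)
  fix g h assume gh: "g \<in> topspace T \<and> h \<in> topspace T \<and> g \<noteq> h"
  then have "\<not> (\<forall>\<phi>. \<phi> \<in> g \<longleftrightarrow> \<phi> \<in> h)" by auto
  then obtain \<phi> where \<phi>: "(\<phi> \<in> g) \<noteq> (\<phi> \<in> h)" by auto
  then have "\<phi> \<in> \<Phi>" using gh Gset_sub by auto
  then have "openin T (near {\<phi>} g)" "openin T (near {\<phi>} h)" by (auto intro!: openin_near)
  moreover have "disjnt (near {\<phi>} g) (near {\<phi>} h)"
    using \<phi> by (auto simp: disjnt_def near_def)
  ultimately show "\<exists>U V. openin T U \<and> openin T V \<and> g \<in> U \<and> h \<in> V \<and> disjnt U V"
    using gh by (intro exI[of _ "near {\<phi>} g"] exI[of _ "near {\<phi>} h"]) (simp add: near_self)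
qed

lemma group_G: "group G"
proof (rule groupI)
  fix x y z assume "x \<in> carrier G" "y \<in> carrier G" "z \<in> carrier G"
  show "x \<otimes>\<^bsub>G\<^esub> y \<otimes>\<^bsub>G\<^esub> z = x \<otimes>\<^bsub>G\<^esub> (y \<otimes>\<^bsub>G\<^esub> z)" by (auto simp: G_def)
qed (auto simp: G_def Gset_empty Gset_sym_diff)

lemma inv_G: "g \<in> Gset \<Longrightarrow> inv\<^bsub>G\<^esub> g = g"
  by (rule group.inv_equality[OF group_G]) (auto simp: G_def)

lemma continuous_sym_diff: "continuous_map (prod_topology T T) T (\<lambda>(x, y). sym_diff x y)"
  unfolding continuous_map_def
proof (intro conjI allI impI)
  show "(\<lambda>(x, y). sym_diff x y) \<in> topspace (prod_topology T T) \<rightarrow> topspace T"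
    using Gset_sym_diff by auto
  fix U assume U: "openin T U"
  show "openin (prod_topology T T) {z \<in> topspace (prod_topology T T). (case z of (x, y) \<Rightarrow> sym_diff x y) \<in> U}"
    unfolding openin_prod_topology_alt
  proof (intro allI impI)
    fix x y assume "(x, y) \<in> {z \<in> topspace (prod_topology T T). (case z of (x, y) \<Rightarrow> sym_diff x y) \<in> U}"
    then have xy: "x \<in> Gset" "y \<in> Gset" "sym_diff x y \<in> U" by auto
    then have "\<exists>F. finite F \<and> F \<subseteq> \<Phi> \<and> near F (sym_diff x y) \<subseteq> U" using U unfolding openin_T by simp
    then obtain F where F: "finite F" "F \<subseteq> \<Phi>" "near F (sym_diff x y) \<subseteq> U" by (elim exE conjE)
    have "near F x \<times> near F y \<subseteq> {z \<in> topspace (prod_topology T T). (case z of (x, y) \<Rightarrow> sym_diff x y) \<in> U}"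
    proof (rule subsetI)
      fix z assume "z \<in> near F x \<times> near F y"
      then obtain x' y' where z: "z = (x', y')" and "x' \<in> near F x" "y' \<in> near F y" by (rule SigmaE)
      then have mem: "x' \<in> Gset" "y' \<in> Gset" and eq: "x' \<inter> F = x \<inter> F" "y' \<inter> F = y \<inter> F"
        by (auto simp: near_def)
      have "sym_diff x' y' \<inter> F = sym_diff (x' \<inter> F) (y' \<inter> F)" by auto
      also have "\<dots> = sym_diff x y \<inter> F" unfolding eq by auto
      finally have "sym_diff x' y' \<in> near F (sym_diff x y)"
        using Gset_sym_diff[OF mem] by (simp add: near_def)
      then have "sym_diff x' y' \<in> U" using F(3) by (rule subsetD[rotated])
      then show "z \<in> {z \<in> topspace (prod_topology T T). (case z of (x, y) \<Rightarrow> sym_diff x y) \<in> U}"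
        using mem by (simp add: z)
    qed
    then show "\<exists>U1 V1. openin T U1 \<and> openin T V1 \<and> x \<in> U1 \<and> y \<in> V1 \<and>
      U1 \<times> V1 \<subseteq> {z \<in> topspace (prod_topology T T). (case z of (x, y) \<Rightarrow> sym_diff x y) \<in> U}"
      using xy openin_near[OF F(1,2)] near_self
      by (intro exI[of _ "near F x"] exI[of _ "near F y"] conjI) simp_all
  qed
qed

lemma topological_group_G: "topological_group G T"
  unfolding topological_group_def
proof (intro conjI)
  show "continuous_map (prod_topology T T) T (\<lambda>(x, y). x \<otimes>\<^bsub>G\<^esub> y)"
    using continuous_sym_diff by (simp add: G_def)
  have "continuous_map T T (\<lambda>x. x)" by simp
  then show "continuous_map T T (\<lambda>x. inv\<^bsub>G\<^esub> x)"
    by (rule continuous_map_eq) (simp add: inv_G)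
qed (simp_all add: group_G, simp add: G_def)

section \<open>Countable pracompactness of the \<open>K\<close>-th power\<close>

text \<open>Neighbourhoods in a power are reduced to conditions on finitely many pairs of a
  character and a coordinate, the form that \<open>indep\<close> can meet.\<close>

lemma product_nbhd:
  assumes "openin (product_topology (\<lambda>_. T) L) U" "y \<in> U"
  obtains C where "finite C" "C \<subseteq> \<Phi> \<times> L"
    "\<And>x. x \<in> (\<Pi>\<^sub>E i\<in>L. Gset) \<Longrightarrow> (\<And>\<phi> i. (\<phi>, i) \<in> C \<Longrightarrow> \<phi> \<in> x i \<longleftrightarrow> \<phi> \<in> y i) \<Longrightarrow> x \<in> U"
proof -
  obtain W where W: "finite {i \<in> L. W i \<noteq> topspace T}" "\<And>i. i \<in> L \<Longrightarrow> openin T (W i)"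
    "y \<in> Pi\<^sub>E L W" "Pi\<^sub>E L W \<subseteq> U"
    using assms unfolding openin_product_topology_alt by meson
  define J where "J = {i \<in> L. W i \<noteq> topspace T}"
  have "\<exists>F. finite F \<and> F \<subseteq> \<Phi> \<and> near F (y i) \<subseteq> W i" if "i \<in> L" for i
  proof -
    have "y i \<in> W i" using W(3) that by (auto simp: PiE_iff)
    then show ?thesis using W(2)[OF that] unfolding openin_T by simp
  qed
  then obtain F where F: "\<And>i. i \<in> L \<Longrightarrow> finite (F i)" "\<And>i. i \<in> L \<Longrightarrow> F i \<subseteq> \<Phi>"
    "\<And>i. i \<in> L \<Longrightarrow> near (F i) (y i) \<subseteq> W i"
    by metis
  define C where "C = (\<Union>i\<in>J. F i \<times> {i})"
  have "finite C" using W(1) F(1) by (auto simp: C_def J_def)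
  moreover have "C \<subseteq> \<Phi> \<times> L" using F(2) by (auto simp: C_def J_def)
  moreover have "x \<in> U" if x: "x \<in> (\<Pi>\<^sub>E i\<in>L. Gset)" "\<And>\<phi> i. (\<phi>, i) \<in> C \<Longrightarrow> \<phi> \<in> x i \<longleftrightarrow> \<phi> \<in> y i" for x
  proof -
    have "x i \<in> W i" if "i \<in> L" for i
    proof (cases "i \<in> J")
      case True
      then have "x i \<inter> F i = y i \<inter> F i" using x(2) by (auto simp: C_def)
      then show ?thesis using F(3)[OF that] x(1) that by (auto simp: PiE_iff near_def)
    next
      case False
      then show ?thesis using that x(1) by (auto simp: J_def PiE_iff)
    qed
    then have "x \<in> Pi\<^sub>E L W" using x(1) by (auto simp: PiE_iff)
    then show ?thesis using W(4) by blast
  qed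
  ultimately show ?thesis using that by blast
qed

text \<open>The dense set consists of the tuples \<open>pt d\<close>; its density is
  \<open>indep\<close>. A sequence \<open>pt (s k)\<close> accumulates because in every coordinate
  \<open>i\<close> the points \<open>(s k, i)\<close> tend to \<open>(Inr s, i)\<close> along the
  same ultrafilter \<open>p s\<close>.\<close>

lemma countably_pracompact_power: "countably_pracompact (product_topology (\<lambda>_. T) K)"
proof -
  let ?X = "product_topology (\<lambda>_. T) K"
  define pt where "pt d = (\<lambda>i\<in>K. gen {(Inl d, i)})" for d :: 'd
  have single: "gen {a} \<in> Gset" if "a \<in> E" for a using that by (auto simp: Gset_def)
  have top: "topspace ?X = (\<Pi>\<^sub>E i\<in>K. Gset)" by simp
  have pt: "pt d \<in> topspace ?X" for d
    unfolding top pt_def using single by (auto simp: PiE_iff E_def)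
  have "y \<in> ?X closure_of (range pt)" if y: "y \<in> topspace ?X" for y
    unfolding in_closure_of
  proof (intro conjI y allI impI)
    fix U assume U: "y \<in> U \<and> openin ?X U"
    obtain C where C: "finite C" "C \<subseteq> \<Phi> \<times> K"
      "\<And>x. x \<in> (\<Pi>\<^sub>E i\<in>K. Gset) \<Longrightarrow> (\<And>\<phi> i. (\<phi>, i) \<in> C \<Longrightarrow> \<phi> \<in> x i \<longleftrightarrow> \<phi> \<in> y i) \<Longrightarrow> x \<in> U"
      using product_nbhd U by metis
    have "C \<subseteq> \<Phi> \<times> UNIV" using C(2) by blast
    then obtain d where d: "\<forall>(\<phi>, i)\<in>C. (d, i) \<in> val \<phi> \<longleftrightarrow> (\<phi>, i) \<in> {(\<phi>, i). \<phi> \<in> y i}"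
      using indep[OF C(1)] by meson
    have "pt d \<in> U"
    proof (rule C(3))
      show "pt d \<in> (\<Pi>\<^sub>E i\<in>K. Gset)" using pt top by simp
      show "\<phi> \<in> pt d i \<longleftrightarrow> \<phi> \<in> y i" if "(\<phi>, i) \<in> C" for \<phi> i
        using d C(2) that by (auto simp: pt_def mem_gen_single)
    qed
    then show "\<exists>z. z \<in> range pt \<and> z \<in> U" by blast
  qed
  then have "topspace ?X \<subseteq> ?X closure_of (range pt)" by (rule subsetI)
  then have "?X closure_of (range pt) = topspace ?X"
    by (rule subset_antisym[OF closure_of_subset_topspace])
  moreover have "?X derived_set_of A \<noteq> {}" if A: "A \<subseteq> range pt" "infinite A" for A
  proof -
    obtain a :: "nat \<Rightarrow> 'k \<Rightarrow> 'f set" where a: "inj a" "range a \<subseteq> A"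
      using infinite_countable_subset[OF A(2)] by blast
    then have "\<exists>d. a k = pt d" for k using A(1) by blast
    then obtain s where s: "\<And>k. a k = pt (s k)" by metis
    have "inj s"
    proof (rule injI)
      fix k l assume "s k = s l"
      then show "k = l" using s a(1) by (simp add: inj_def)
    qed
    define y where "y = (\<lambda>i\<in>K. gen {(Inr s, i)})"
    have y: "y \<in> topspace ?X"
      unfolding top y_def using single \<open>inj s\<close> by (auto simp: PiE_iff E_def)
    have "y \<in> ?X derived_set_of A"
      unfolding in_derived_set_of
    proof (intro conjI y allI impI)
      fix U assume U: "y \<in> U \<and> openin ?X U"
      obtain C where C: "finite C" "C \<subseteq> \<Phi> \<times> K"
        "\<And>x. x \<in> (\<Pi>\<^sub>E i\<in>K. Gset) \<Longrightarrow> (\<And>\<phi> i. (\<phi>, i) \<in> C \<Longrightarrow> \<phi> \<in> x i \<longleftrightarrow> \<phi> \<in> y i) \<Longrightarrow> x \<in> U"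
        using product_nbhd U by metis
      define M where "M c = {k. fst c \<in> a k (snd c) \<longleftrightarrow> fst c \<in> y (snd c)}" for c
      have M: "M c \<in> p s" if c: "c \<in> C" for c
      proof -
        obtain \<phi> i where ci: "c = (\<phi>, i)" "\<phi> \<in> \<Phi>" "i \<in> K" using c C(2) by auto
        have "{k. \<phi> \<in> a k i} = {k. (s k, i) \<in> val \<phi>}"
          using ci by (simp add: s pt_def mem_gen_single)
        moreover have "\<phi> \<in> y i \<longleftrightarrow> {k. (s k, i) \<in> val \<phi>} \<in> p s"
          using ci by (simp add: y_def mem_gen_single ev_Inr)
        ultimately have *: "\<phi> \<in> y i \<longleftrightarrow> {k. \<phi> \<in> a k i} \<in> p s" by simp
        show ?thesis
        proof (cases "\<phi> \<in> y i")
          case True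
          then show ?thesis using * by (simp add: M_def ci)
        next
          case False
          then have "- {k. \<phi> \<in> a k i} \<in> p s" using * free_ultrafilterD(5)[OF ultra] by blast
          then show ?thesis using False by (simp add: M_def ci Collect_neg_eq)
        qed
      qed
      have "(\<Inter>c\<in>C. M c) \<in> p s" by (rule free_ultrafilter_finite_INT[OF ultra C(1) M])
      then have "infinite (\<Inter>c\<in>C. M c)" using free_ultrafilterD(6)[OF ultra] by blast
      \<comment> \<open>Injectivity of \<open>a\<close> leaves at most one index with
        \<open>a k = y\<close>, so a term other than \<open>y\<close> can be picked.\<close>
      then have "infinite ((\<Inter>c\<in>C. M c) - {k. a k = y})"
      proof (rule Diff_infinite_finite[rotated])
        have "{k. a k = y} = a -` {y}" by auto
        then show "finite {k. a k = y}" using a(1) by (simp add: finite_vimageI)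
      qed
      then have "(\<Inter>c\<in>C. M c) - {k. a k = y} \<noteq> {}" by (rule infinite_imp_nonempty)
      then obtain k where k: "\<And>c. c \<in> C \<Longrightarrow> k \<in> M c" "a k \<noteq> y" by auto
      have "a k \<in> U"
      proof (rule C(3))
        show "a k \<in> (\<Pi>\<^sub>E i\<in>K. Gset)" using pt s top by simp
        show "\<phi> \<in> a k i \<longleftrightarrow> \<phi> \<in> y i" if "(\<phi>, i) \<in> C" for \<phi> i
          using k(1)[OF that] by (simp add: M_def)
      qed
      then show "\<exists>z. z \<noteq> y \<and> z \<in> A \<and> z \<in> U" using k(2) a(2) by blast
    qed
    then show ?thesis by blast
  qed
  moreover have "range pt \<subseteq> topspace ?X" using pt by blast
  ultimately show ?thesis unfolding countably_pracompact_def by blast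
qed

section \<open>Failure in the power with successor exponent\<close>

lemma infinite_Gset:
  assumes "infinite (UNIV :: 'd set)" "K \<noteq> {}"
  shows "infinite Gset"
proof -
  obtain i where i: "i \<in> K" using assms(2) by blast
  have "inj (\<lambda>d. gen {(Inl d, i)})"
  proof (rule injI, rule ccontr)
    fix d d' assume eq: "gen {(Inl d, i)} = gen {(Inl d', i)}" and ne: "d \<noteq> d'"
    obtain \<phi> where \<phi>: "\<phi> \<in> \<Phi>" "val \<phi> \<inter> {(d, i), (d', i)} = {(d, i)} \<inter> {(d, i), (d', i)}"
      using sep[of "{(d, i), (d', i)}" "{(d, i)}"] by auto
    then have "\<phi> \<in> gen {(Inl d, i)}" "\<phi> \<notin> gen {(Inl d', i)}"
      using ne by (auto simp: mem_gen_single)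
    then show False using eq by simp
  qed
  then have "infinite (range (\<lambda>d. gen {(Inl d, i)}))" using assms(1) by (simp add: finite_image_iff)
  moreover have "range (\<lambda>d. gen {(Inl d, i)}) \<subseteq> Gset" using i by (auto simp: Gset_def E_def)
  ultimately show ?thesis using finite_subset by blast
qed

text \<open>Members are added one by one. The new \<open>h\<close> has to avoid \<open>R\<close>
  and, as the group has exponent two, the finitely many translates of \<open>R\<close> by earlier
  members.\<close>

lemma exists_generic_family:
  assumes inf: "infinite Gset" and R: "finite R" and I: "finite I"
  shows "\<exists>g. (\<forall>\<alpha>\<in>I. g \<alpha> \<in> Gset - R) \<and> (\<forall>\<alpha>\<in>I. \<forall>\<beta>\<in>I. \<alpha> \<noteq> \<beta> \<longrightarrow> sym_diff (g \<alpha>) (g \<beta>) \<notin> R)"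
  using I
proof (induction I)
  case (insert a I)
  then obtain g where g: "\<And>\<alpha>. \<alpha> \<in> I \<Longrightarrow> g \<alpha> \<in> Gset - R"
    "\<And>\<alpha> \<beta>. \<alpha> \<in> I \<Longrightarrow> \<beta> \<in> I \<Longrightarrow> \<alpha> \<noteq> \<beta> \<Longrightarrow> sym_diff (g \<alpha>) (g \<beta>) \<notin> R" by metis
  have "infinite (Gset - (R \<union> (\<Union>\<beta>\<in>I. sym_diff (g \<beta>) ` R)))"
    using inf R insert.hyps by (intro Diff_infinite_finite) auto
  then have "Gset - (R \<union> (\<Union>\<beta>\<in>I. sym_diff (g \<beta>) ` R)) \<noteq> {}" by (rule infinite_imp_nonempty)
  then obtain h where "h \<in> Gset - (R \<union> (\<Union>\<beta>\<in>I. sym_diff (g \<beta>) ` R))" by (meson ex_in_conv)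
  then have h: "h \<in> Gset" "h \<notin> R" "\<And>\<beta>. \<beta> \<in> I \<Longrightarrow> h \<notin> sym_diff (g \<beta>) ` R" by simp_all
  have new: "sym_diff h (g \<beta>) \<notin> R" if "\<beta> \<in> I" for \<beta>
  proof
    assume "sym_diff h (g \<beta>) \<in> R"
    moreover have "h = sym_diff (g \<beta>) (sym_diff h (g \<beta>))" by blast
    ultimately have "h \<in> sym_diff (g \<beta>) ` R" by (rule rev_image_eqI)
    then show False using h(3)[OF that] by simp
  qed
  then have new': "sym_diff (g \<beta>) h \<notin> R" if "\<beta> \<in> I" for \<beta>
    using new[OF that] by (metis Un_commute)
  have mem: "(g(a := h)) \<alpha> \<in> Gset - R" if "\<alpha> \<in> insert a I" for \<alpha>
    using g(1)[of \<alpha>] h(1,2) that by (cases "\<alpha> = a") simp_all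
  have "sym_diff ((g(a := h)) \<alpha>) ((g(a := h)) \<beta>) \<notin> R"
    if "\<alpha> \<in> insert a I" "\<beta> \<in> insert a I" "\<alpha> \<noteq> \<beta>" for \<alpha> \<beta>
    using g(2)[of \<alpha> \<beta>] new[of \<beta>] new'[of \<alpha>] that by (cases "\<alpha> = a"; cases "\<beta> = a") simp_all
  with mem show ?case by (intro exI[of _ "g(a := h)"] conjI ballI impI)
qed simp

text \<open>The requirements are finitely many open conditions, and
  \<open>exists_generic_family\<close> shows that they can be met together.\<close>

lemma dense_meets_generic:
  assumes inf: "infinite Gset" and R: "finite R" and I: "finite I" "I \<subseteq> L"
    and D: "topspace (product_topology (\<lambda>_. T) L) \<subseteq> Abstract_Topology.closure_of (product_topology (\<lambda>_. T) L) D"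
  shows "\<exists>x\<in>D. (\<forall>\<alpha>\<in>I. x \<alpha> \<notin> R) \<and> (\<forall>\<alpha>\<in>I. \<forall>\<beta>\<in>I. \<alpha> \<noteq> \<beta> \<longrightarrow> sym_diff (x \<alpha>) (x \<beta>) \<notin> R)"
proof -
  let ?X = "product_topology (\<lambda>_. T) L"
  have op: "openin T (Gset - R)"
  proof -
    have "closedin T (Gset \<inter> R)" using R by (intro closedin_Hausdorff_finite[OF Hausdorff_T]) auto
    then have "openin T (topspace T - Gset \<inter> R)" by (rule openin_diff[OF openin_topspace])
    moreover have "topspace T - Gset \<inter> R = Gset - R" by auto
    ultimately show ?thesis by simp
  qed
  have proj: "continuous_map ?X T (\<lambda>z. z \<alpha>)" if "\<alpha> \<in> I" for \<alpha>
    using I(2) that by (intro continuous_map_product_projection) auto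
  \<comment> \<open>Diagonal pairs encode the condition on a single coordinate, the others the
    condition on a difference.\<close>
  define U where "U c = {z \<in> topspace ?X. (if fst c = snd c then z (fst c) else sym_diff (z (fst c)) (z (snd c))) \<in> Gset - R}" for c
  have U: "openin ?X (U c)" if "c \<in> I \<times> I" for c
  proof -
    have "continuous_map ?X T (\<lambda>z. case (z (fst c), z (snd c)) of (x, y) \<Rightarrow> sym_diff x y)"
      using that continuous_map_compose[OF continuous_map_pairedI[OF proj proj] continuous_sym_diff, of "fst c" "snd c"]
      by (auto simp: o_def)
    then have "continuous_map ?X T (\<lambda>z. if fst c = snd c then z (fst c) else sym_diff (z (fst c)) (z (snd c)))"
      using that proj by (cases "fst c = snd c") auto
    from openin_continuous_map_preimage[OF this op] show ?thesis by (simp only: U_def)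
  qed
  obtain g where g: "\<And>\<alpha>. \<alpha> \<in> I \<Longrightarrow> g \<alpha> \<in> Gset - R"
    "\<And>\<alpha> \<beta>. \<alpha> \<in> I \<Longrightarrow> \<beta> \<in> I \<Longrightarrow> \<alpha> \<noteq> \<beta> \<Longrightarrow> sym_diff (g \<alpha>) (g \<beta>) \<notin> R"
    using exists_generic_family[OF inf R I(1)] by metis
  define z where "z = (\<lambda>\<alpha>\<in>L. if \<alpha> \<in> I then g \<alpha> else {})"
  have zI: "z \<alpha> = g \<alpha>" if "\<alpha> \<in> I" for \<alpha> using that I(2) by (auto simp: z_def)
  have zt: "z \<in> topspace ?X" using g(1) Gset_empty by (auto simp: z_def)
  have zU: "z \<in> U c" if cI: "c \<in> I \<times> I" for c
  proof -
    obtain \<alpha> \<beta> where c: "c = (\<alpha>, \<beta>)" "\<alpha> \<in> I" "\<beta> \<in> I" using cI by (rule SigmaE)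
    have "sym_diff (g \<alpha>) (g \<beta>) \<in> Gset" using g(1) c by (intro Gset_sym_diff) auto
    then show ?thesis using g c zt by (simp add: U_def zI del: topspace_product_topology)
  qed
  let ?W = "(\<Inter>c\<in>I \<times> I. U c) \<inter> topspace ?X"
  have "openin ?X ?W" using I(1) U by (intro openin_INT) auto
  moreover have "z \<in> ?W" using zU zt by blast
  moreover have "z \<in> Abstract_Topology.closure_of ?X D" using D zt by (rule subsetD)
  ultimately obtain x where x: "x \<in> D" "x \<in> ?W" unfolding in_closure_of by blast
  have "x \<alpha> \<notin> R" if "\<alpha> \<in> I" for \<alpha>
  proof -
    have "x \<in> U (\<alpha>, \<alpha>)" using x(2) that by blast
    then show ?thesis by (simp add: U_def)
  qed
  moreover have "sym_diff (x \<alpha>) (x \<beta>) \<notin> R" if "\<alpha> \<in> I" "\<beta> \<in> I" "\<alpha> \<noteq> \<beta>" for \<alpha> \<beta>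
  proof -
    have "x \<in> U (\<alpha>, \<beta>)" using x(2) that by blast
    then show ?thesis using that by (simp add: U_def)
  qed
  ultimately show ?thesis using x(1) by blast
qed

text \<open>The filter is generated by the index sets of the neighbourhoods of an accumulation point
  together with the cofinite sets. It is proper because in a Hausdorff space each such neighbourhood
  contains infinitely many terms.\<close>

lemma accumulation_conv:
  fixes x :: "nat \<Rightarrow> 'm \<Rightarrow> 'f set"
  assumes x: "inj x" "range x \<subseteq> topspace (product_topology (\<lambda>_. T) L)"
    and acc: "(product_topology (\<lambda>_. T) L) derived_set_of (range x) \<noteq> {}"
  shows "\<exists>Q y. free_filter Q \<and> y \<in> topspace (product_topology (\<lambda>_. T) L) \<and>
    (\<forall>\<alpha>\<in>L. conv Q (\<lambda>n. rep (x n \<alpha>)) (rep (y \<alpha>)))"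
proof -
  let ?X = "product_topology (\<lambda>_. T) L"
  have "Hausdorff_space ?X" using Hausdorff_T by (simp add: Hausdorff_space_product_topology)
  then obtain y where y: "y \<in> topspace ?X" "\<And>U. y \<in> U \<Longrightarrow> openin ?X U \<Longrightarrow> infinite (range x \<inter> U)"
    using acc unfolding derived_set_of_infinite_openin[OF \<open>Hausdorff_space ?X\<close>] by auto
  define Q where "Q = {N. \<exists>U F. openin ?X U \<and> y \<in> U \<and> finite F \<and> {n. x n \<in> U} - F \<subseteq> N}"
  have QI: "N \<in> Q" if "openin ?X U" "y \<in> U" "finite F" "{n. x n \<in> U} - F \<subseteq> N" for N U F
    unfolding Q_def using that by (intro CollectI exI conjI)
  have QD: "\<exists>U F. openin ?X U \<and> y \<in> U \<and> finite F \<and> {n. x n \<in> U} - F \<subseteq> N" if "N \<in> Q" for N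
    using that unfolding Q_def by (rule CollectD)
  have "free_filter Q"
    unfolding free_filter_def
  proof (intro conjI allI impI)
    show "{} \<notin> Q"
    proof
      assume "{} \<in> Q"
      then obtain U F where UF: "openin ?X U" "y \<in> U" "finite F" "{n. x n \<in> U} - F \<subseteq> {}"
        using QD by meson
      then have "{n. x n \<in> U} \<subseteq> F" by simp
      then have "finite (x ` {n. x n \<in> U})" using UF(3) by (metis finite_imageI finite_subset)
      moreover have "range x \<inter> U = x ` {n. x n \<in> U}" by auto
      ultimately show False using y(2)[OF UF(2,1)] by simp
    qed
    show "B \<in> Q" if AB: "A \<in> Q \<and> A \<subseteq> B" for A B
    proof -
      obtain U F where UF: "openin ?X U" "y \<in> U" "finite F" "{n. x n \<in> U} - F \<subseteq> A"
        using QD AB by meson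
      show ?thesis using AB by (intro QI[OF UF(1-3)] order_trans[OF UF(4)]) simp
    qed
    show "A \<inter> B \<in> Q" if AB: "A \<in> Q \<and> B \<in> Q" for A B
    proof -
      obtain U F where 1: "openin ?X U" "y \<in> U" "finite F" "{n. x n \<in> U} - F \<subseteq> A"
        using QD AB by meson
      obtain V H where 2: "openin ?X V" "y \<in> V" "finite H" "{n. x n \<in> V} - H \<subseteq> B"
        using QD AB by meson
      have "{n. x n \<in> U \<inter> V} - (F \<union> H) \<subseteq> A \<inter> B" using 1(4) 2(4) by auto
      then show ?thesis
        using 1(2,3) 2(2,3) by (intro QI[of "U \<inter> V" "F \<union> H"] openin_Int[OF 1(1) 2(1)]) simp_all
    qed
    show "- F \<in> Q" if "finite F" for F
      by (rule QI[OF openin_topspace y(1) that]) auto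
  qed
  moreover have "conv Q (\<lambda>n. rep (x n \<alpha>)) (rep (y \<alpha>))" if \<alpha>: "\<alpha> \<in> L" for \<alpha>
    unfolding conv_def
  proof
    fix \<phi> assume \<phi>: "\<phi> \<in> \<Phi>"
    have xG: "x n \<alpha> \<in> Gset" for n
    proof -
      have "x n \<in> topspace ?X" using x(2) by blast
      then show ?thesis using \<alpha> by (simp add: PiE_iff)
    qed
    have yG: "y \<alpha> \<in> Gset" using y(1) \<alpha> by (simp add: PiE_iff)
    let ?U = "{z \<in> topspace ?X. z \<alpha> \<in> near {\<phi>} (y \<alpha>)}"
    have "openin ?X ?U"
      using \<phi> \<alpha> by (intro openin_continuous_map_preimage[OF continuous_map_product_projection] openin_near) auto
    moreover have "y \<in> ?U" using y(1) near_self[OF yG] by blast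
    moreover have "{n. x n \<in> ?U} - {} \<subseteq> {n. par (val \<phi>) (rep (x n \<alpha>)) = par (val \<phi>) (rep (y \<alpha>))}"
      by (auto simp: par_rep[OF xG \<phi>] par_rep[OF yG \<phi>] near_def)
    ultimately show "{n. par (val \<phi>) (rep (x n \<alpha>)) = par (val \<phi>) (rep (y \<alpha>))} \<in> Q"
      by (rule QI[OF _ _ finite.emptyI])
  qed
  ultimately show ?thesis using y(1) by blast
qed

text \<open>Modulo sums from \<open>S\<close>, the element \<open>x \<alpha>\<close> is the sum of
  the \<open>(d \<alpha>, i)\<close> with \<open>i \<in> J \<alpha>\<close>, for a single
  \<open>d \<alpha>\<close> outside \<open>H\<close>. There are more \<open>\<alpha>\<close> than
  possible \<open>J \<alpha>\<close>, so two of them share it; if \<open>d\<close> agreed as well,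
  their difference would be represented inside \<open>S\<close>, contrary to genericity.\<close>

lemma points_of_generic_pair:
  assumes Y: "\<And>\<alpha>. \<alpha> \<in> I \<Longrightarrow> rel_compact (Y \<alpha>)" and x: "\<And>\<alpha>. \<alpha> \<in> I \<Longrightarrow> x \<alpha> \<in> Gset \<and> rep (x \<alpha>) \<in> Y \<alpha>"
    and \<kappa>: "\<And>\<alpha>. \<alpha> \<in> I \<Longrightarrow> {i. \<exists>A\<in>Y \<alpha>. \<exists>d. (Inl d, i) \<in> A} = \<kappa>"
    and I: "finite I" "card I > card (Pow \<kappa>)" and fin: "finite \<kappa>"
    and H: "\<And>\<alpha> A d d'. \<alpha> \<in> I \<Longrightarrow> A \<in> Y \<alpha> \<Longrightarrow> d \<in> dpart A - H \<Longrightarrow> d' \<in> dpart A - H \<Longrightarrow> d = d'"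
    and S: "S = (\<Union>\<alpha>\<in>I. \<Union>(Y \<alpha>) \<inter> limits) \<union> (Inl ` H) \<times> \<kappa>"
    and R: "\<And>\<alpha>. \<alpha> \<in> I \<Longrightarrow> x \<alpha> \<notin> gen ` Pow S"
      "\<And>\<alpha> \<beta>. \<alpha> \<in> I \<Longrightarrow> \<beta> \<in> I \<Longrightarrow> \<alpha> \<noteq> \<beta> \<Longrightarrow> sym_diff (x \<alpha>) (x \<beta>) \<notin> gen ` Pow S"
  shows "\<exists>\<alpha>\<in>I. \<exists>\<beta>\<in>I. \<exists>d\<in>dpart (rep (x \<alpha>)) - H. \<exists>d'\<in>dpart (rep (x \<beta>)) - H. d \<noteq> d'"
proof -
  have in_S: "a \<in> S" if \<alpha>: "\<alpha> \<in> I" and a: "a \<in> rep (x \<alpha>)" "fst a \<notin> Inl ` (dpart (rep (x \<alpha>)) - H)" for \<alpha> a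
  proof (cases a)
    case (Pair c i)
    show ?thesis
    proof (cases c)
      case (Inl d)
      have "d \<in> dpart (rep (x \<alpha>))" using a(1) by (auto simp: dpart_def Pair Inl)
      then have "d \<in> H" using a(2) by (auto simp: Pair Inl)
      moreover have "i \<in> {i. \<exists>A\<in>Y \<alpha>. \<exists>d. (Inl d, i) \<in> A}"
        using a(1) x[OF \<alpha>] by (auto simp: Pair Inl)
      then have "i \<in> \<kappa>" using \<kappa>[OF \<alpha>] by simp
      ultimately show ?thesis by (simp add: S Pair Inl)
    next
      case (Inr s)
      have "a \<in> \<Union>(Y \<alpha>) \<inter> limits" using a(1) x[OF \<alpha>] by (auto simp: Pair Inr limits_def)
      then show ?thesis using \<alpha> unfolding S by blast
    qed
  qed
  have "\<exists>d. d \<in> dpart (rep (x \<alpha>)) - H" if \<alpha>: "\<alpha> \<in> I" for \<alpha>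
  proof (rule ccontr)
    assume "\<not> ?thesis"
    then have "dpart (rep (x \<alpha>)) - H = {}" by blast
    then have "rep (x \<alpha>) \<subseteq> S" using in_S[OF \<alpha>] by auto
    then have "gen (rep (x \<alpha>)) \<in> gen ` Pow S" by blast
    then show False using R(1)[OF \<alpha>] rep(3) x[OF \<alpha>] by simp
  qed
  then obtain d where d: "\<And>\<alpha>. \<alpha> \<in> I \<Longrightarrow> d \<alpha> \<in> dpart (rep (x \<alpha>)) - H" by metis
  have d_only: "dpart (rep (x \<alpha>)) - H = {d \<alpha>}" if \<alpha>: "\<alpha> \<in> I" for \<alpha>
    using d[OF \<alpha>] H[OF \<alpha> conjunct2[OF x[OF \<alpha>]]] by auto
  define J where "J \<alpha> = {i. (Inl (d \<alpha>), i) \<in> rep (x \<alpha>)}" for \<alpha>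
  have "J \<alpha> \<subseteq> \<kappa>" if \<alpha>: "\<alpha> \<in> I" for \<alpha>
    using \<kappa>[OF \<alpha>] x[OF \<alpha>] unfolding J_def by blast
  then have "card (J ` I) \<le> card (Pow \<kappa>)" using fin by (intro card_mono) auto
  then have "\<not> inj_on J I" using I(2) by (auto dest: card_image)
  then obtain \<alpha> \<beta> where ab: "\<alpha> \<in> I" "\<beta> \<in> I" "\<alpha> \<noteq> \<beta>" "J \<alpha> = J \<beta>"
    unfolding inj_on_def by blast
  have "d \<alpha> \<noteq> d \<beta>"
  proof
    assume eq: "d \<alpha> = d \<beta>"
    have "sym_diff (rep (x \<alpha>)) (rep (x \<beta>)) \<subseteq> S"
    proof
      fix a assume a: "a \<in> sym_diff (rep (x \<alpha>)) (rep (x \<beta>))"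
      have "fst a \<noteq> Inl (d \<alpha>)"
      proof
        assume "fst a = Inl (d \<alpha>)"
        then have "a \<in> rep (x \<alpha>) \<longleftrightarrow> snd a \<in> J \<alpha>" "a \<in> rep (x \<beta>) \<longleftrightarrow> snd a \<in> J \<beta>"
          using eq by (cases a; simp add: J_def)+
        then show False using a ab(4) by auto
      qed
      then show "a \<in> S" using a in_S[OF ab(1), of a] in_S[OF ab(2), of a] d_only[OF ab(1)] d_only[OF ab(2)] eq
        by auto
    qed
    then have "gen (sym_diff (rep (x \<alpha>)) (rep (x \<beta>))) \<in> gen ` Pow S" by blast
    moreover have "x \<alpha> \<in> Gset" "x \<beta> \<in> Gset" using x ab by blast+
    then have "gen (sym_diff (rep (x \<alpha>)) (rep (x \<beta>))) = sym_diff (x \<alpha>) (x \<beta>)"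
      by (simp add: gen_sym_diff rep)
    ultimately show False using R(2)[OF ab(1-3)] by (simp only:)
  qed
  then show ?thesis using ab(1,2) d by blast
qed

text \<open>Each projection of the dense set \<open>D\<close> satisfies \<open>rel_compact\<close>.
  Generic elements yield two coordinates and a sequence in \<open>D\<close> with different new
  points in them, which cannot converge in both coordinates along one filter.\<close>

lemma not_countably_pracompact_power:
  fixes L :: "'m set"
  assumes inf: "infinite (UNIV :: 'd set)" "infinite K"
    and L: "(card_of L, cardSuc (card_of K)) \<in> ordIso"
  shows "\<not> countably_pracompact (product_topology (\<lambda>_. T) L)"
proof
  let ?X = "product_topology (\<lambda>_. T) L"
  assume "countably_pracompact ?X"
  then obtain D where D: "D \<subseteq> topspace ?X" "Abstract_Topology.closure_of ?X D = topspace ?X"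
    and acc: "\<And>A. A \<subseteq> D \<Longrightarrow> infinite A \<Longrightarrow> ?X derived_set_of A \<noteq> {}"
    unfolding countably_pracompact_def by blast
  have DG: "x \<alpha> \<in> Gset" if "x \<in> D" "\<alpha> \<in> L" for x \<alpha>
  proof -
    have "x \<in> topspace ?X" using D(1) that(1) by (rule subsetD)
    then show ?thesis using that(2) by (simp add: PiE_iff)
  qed
  have seq: "\<exists>Q y. free_filter Q \<and> (\<forall>\<alpha>\<in>L. y \<alpha> \<in> Gset \<and> conv Q (\<lambda>n. rep (x n \<alpha>)) (rep (y \<alpha>)))"
    if x: "inj x" "range x \<subseteq> D" for x :: "nat \<Rightarrow> 'm \<Rightarrow> 'f set"
  proof -
    have "infinite (range x)" using x(1) by (rule range_inj_infinite)
    then have "?X derived_set_of (range x) \<noteq> {}" by (rule acc[OF x(2)])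
    from accumulation_conv[OF x(1) order_trans[OF x(2) D(1)] this]
    obtain Q y where "free_filter Q" "y \<in> topspace ?X" "\<forall>\<alpha>\<in>L. conv Q (\<lambda>n. rep (x n \<alpha>)) (rep (y \<alpha>))"
      by (elim exE conjE)
    moreover have "\<forall>\<alpha>\<in>L. y \<alpha> \<in> Gset" using calculation(2) by (simp add: PiE_iff)
    ultimately show ?thesis by (intro exI[of _ Q] exI[of _ y]) simp
  qed
  define Y where "Y \<alpha> = (\<lambda>x. rep (x \<alpha>)) ` D" for \<alpha>
  have Y: "rel_compact (Y \<alpha>)" if \<alpha>: "\<alpha> \<in> L" for \<alpha>
    unfolding rel_compact_def
  proof (intro conjI ballI allI impI)
    show "finite A" "A \<subseteq> E" if "A \<in> Y \<alpha>" for A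
      using that DG[OF _ \<alpha>] rep by (auto simp: Y_def)
    fix A :: "nat \<Rightarrow> (('d + (nat \<Rightarrow> 'd)) \<times> 'k) set" assume A: "inj A \<and> range A \<subseteq> Y \<alpha>"
    have "\<exists>x\<in>D. A n = rep (x \<alpha>)" for n using A unfolding Y_def by blast
    then obtain x where x: "\<And>n. x n \<in> D" "\<And>n. A n = rep (x n \<alpha>)" by metis
    have "inj x"
    proof (rule injI)
      fix m n assume "x m = x n"
      then have "A m = A n" using x(2) by simp
      then show "m = n" using A by (simp add: inj_def)
    qed
    moreover have "range x \<subseteq> D" using x(1) by blast
    ultimately obtain Q y where Qy: "free_filter Q" "y \<alpha> \<in> Gset" "conv Q (\<lambda>n. rep (x n \<alpha>)) (rep (y \<alpha>))"
      using seq[of x] \<alpha> by auto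
    have "A = (\<lambda>n. rep (x n \<alpha>))" using x(2) by (rule ext)
    then show "\<exists>Q B. free_filter Q \<and> finite B \<and> B \<subseteq> E \<and> conv Q A B"
      using Qy rep(1,2)[OF Qy(2)] by (intro exI[of _ Q] exI[of _ "rep (y \<alpha>)"]) simp
  qed
  define ks where "ks \<alpha> = {i. \<exists>A\<in>Y \<alpha>. \<exists>d. (Inl d, i) \<in> A}" for \<alpha>
  have ks: "finite (ks \<alpha>) \<and> ks \<alpha> \<subseteq> K" if \<alpha>: "\<alpha> \<in> L" for \<alpha>
  proof
    show "finite (ks \<alpha>)" unfolding ks_def by (rule rel_compact_coordinates[OF Y[OF \<alpha>]])
    have "A \<subseteq> E" if "A \<in> Y \<alpha>" for A using Y[OF \<alpha>] that unfolding rel_compact_def by blast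
    then show "ks \<alpha> \<subseteq> K" unfolding ks_def E_def by blast
  qed
  obtain \<kappa> where \<kappa>: "infinite {\<alpha>\<in>L. ks \<alpha> = \<kappa>}"
    using infinite_fiber_cardSuc[where f = ks, OF inf(2) L ks] by blast
  \<comment> \<open>One coordinate more than \<open>\<kappa>\<close> has subsets, for the pigeonhole
    in \<open>points_of_generic_pair\<close>.\<close>
  obtain I where I: "finite I" "card I = Suc (card (Pow \<kappa>))" "I \<subseteq> {\<alpha>\<in>L. ks \<alpha> = \<kappa>}"
    using infinite_arbitrarily_large[OF \<kappa>] by blast
  then have IL: "I \<subseteq> L" and I\<kappa>: "\<And>\<alpha>. \<alpha> \<in> I \<Longrightarrow> ks \<alpha> = \<kappa>" by auto
  have "I \<noteq> {}" using I(2) by auto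
  then have fin: "finite \<kappa>" using ks I\<kappa> IL by blast
  have "\<exists>H. finite H \<and> (\<forall>A\<in>Y \<alpha>. \<forall>d\<in>dpart A - H. \<forall>d'\<in>dpart A - H. d = d')" if "\<alpha> \<in> I" for \<alpha>
    by (rule rel_compact_one_new_point) (use Y IL that in blast)
  then obtain H where H: "\<And>\<alpha>. \<alpha> \<in> I \<Longrightarrow> finite (H \<alpha>)"
    "\<And>\<alpha> A d d'. \<alpha> \<in> I \<Longrightarrow> A \<in> Y \<alpha> \<Longrightarrow> d \<in> dpart A - H \<alpha> \<Longrightarrow> d' \<in> dpart A - H \<alpha> \<Longrightarrow> d = d'"
    by metis
  define P where "P \<alpha> \<beta> x F \<longleftrightarrow> (\<exists>d\<in>dpart (rep (x \<alpha>)) - F. \<exists>d'\<in>dpart (rep (x \<beta>)) - F. d \<noteq> d')"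
    for \<alpha> \<beta> and x :: "'m \<Rightarrow> 'f set" and F
  have P_anti: "P \<alpha> \<beta> x F" if "P \<alpha> \<beta> x F'" "F \<subseteq> F'" for \<alpha> \<beta> x F F'
    using that unfolding P_def by blast
  have pair: "\<exists>x\<in>D. \<exists>\<alpha>\<in>I. \<exists>\<beta>\<in>I. P \<alpha> \<beta> x F" if F: "finite F" for F
  proof -
    \<comment> \<open>Outside the exceptional sets \<open>H \<alpha>\<close> each element has at
      most one first coordinate left.\<close>
    define H' where "H' = F \<union> (\<Union>\<alpha>\<in>I. H \<alpha>)"
    define S where "S = (\<Union>\<alpha>\<in>I. \<Union>(Y \<alpha>) \<inter> limits) \<union> (Inl ` H') \<times> \<kappa>"
    have "finite (\<Union>(Y \<alpha>) \<inter> limits)" if "\<alpha> \<in> I" for \<alpha>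
      by (rule rel_compact_limits, rule Y) (use IL that in blast)
    then have "finite S" using F H(1) I(1) fin unfolding S_def H'_def by blast
    then have "finite (gen ` Pow S)" by (intro finite_imageI) simp
    have K: "K \<noteq> {}" using inf(2) by (rule infinite_imp_nonempty)
    obtain x where x0: "x \<in> D" "\<forall>\<alpha>\<in>I. x \<alpha> \<notin> gen ` Pow S"
      "\<forall>\<alpha>\<in>I. \<forall>\<beta>\<in>I. \<alpha> \<noteq> \<beta> \<longrightarrow> sym_diff (x \<alpha>) (x \<beta>) \<notin> gen ` Pow S"
      using dense_meets_generic[OF infinite_Gset[OF inf(1) K] \<open>finite (gen ` Pow S)\<close> I(1) IL
          equalityD2[OF D(2)]] by (elim bexE conjE)
    then have x: "x \<in> D" "\<And>\<alpha>. \<alpha> \<in> I \<Longrightarrow> x \<alpha> \<notin> gen ` Pow S"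
      "\<And>\<alpha> \<beta>. \<alpha> \<in> I \<Longrightarrow> \<beta> \<in> I \<Longrightarrow> \<alpha> \<noteq> \<beta> \<Longrightarrow> sym_diff (x \<alpha>) (x \<beta>) \<notin> gen ` Pow S"
      by (simp_all del: Pow_iff)
    have "\<exists>\<alpha>\<in>I. \<exists>\<beta>\<in>I. P \<alpha> \<beta> x H'"
      unfolding P_def
    proof (rule points_of_generic_pair[where Y = Y and \<kappa> = \<kappa> and S = S])
      show "rel_compact (Y \<alpha>)" if "\<alpha> \<in> I" for \<alpha> using Y IL that by blast
      show "x \<alpha> \<in> Gset \<and> rep (x \<alpha>) \<in> Y \<alpha>" if "\<alpha> \<in> I" for \<alpha>
        using DG[OF x(1)] x(1) IL that by (auto simp: Y_def)
      show "{i. \<exists>A\<in>Y \<alpha>. \<exists>d. (Inl d, i) \<in> A} = \<kappa>" if "\<alpha> \<in> I" for \<alpha>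
        using I\<kappa>[OF that] by (simp add: ks_def)
      show "d = d'" if "\<alpha> \<in> I" "A \<in> Y \<alpha>" "d \<in> dpart A - H'" "d' \<in> dpart A - H'" for \<alpha> A d d'
        using H(2)[OF that(1,2)] that unfolding H'_def by blast
    qed (use I fin S_def x in auto)
    then obtain \<alpha> \<beta> where ab: "\<alpha> \<in> I" "\<beta> \<in> I" "P \<alpha> \<beta> x H'" by (elim bexE)
    have "P \<alpha> \<beta> x F" using ab(3) by (rule P_anti) (simp add: H'_def)
    then show ?thesis using x(1) ab(1,2) by blast
  qed
  \<comment> \<open>The pair found above may vary with \<open>F\<close>. There are finitely many
    pairs and \<open>P\<close> is antitone in \<open>F\<close>, so one pair serves all finite
    \<open>F\<close>.\<close>
  have "\<exists>c\<in>I \<times> I. \<forall>F. finite F \<longrightarrow> (\<exists>x\<in>D. P (fst c) (snd c) x F)"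
  proof (rule ccontr)
    assume "\<not> ?thesis"
    then obtain F where F: "\<And>c. c \<in> I \<times> I \<Longrightarrow> finite (F c)"
      "\<And>c x. c \<in> I \<times> I \<Longrightarrow> x \<in> D \<Longrightarrow> \<not> P (fst c) (snd c) x (F c)" by metis
    have "finite (\<Union>c\<in>I \<times> I. F c)" using F(1) I(1) by blast
    from pair[OF this] obtain x \<alpha> \<beta> where x: "x \<in> D" "\<alpha> \<in> I" "\<beta> \<in> I" "P \<alpha> \<beta> x (\<Union>c\<in>I \<times> I. F c)"
      by (elim bexE)
    have "F (\<alpha>, \<beta>) \<subseteq> (\<Union>c\<in>I \<times> I. F c)" using x by blast
    from P_anti[OF x(4) this] show False using F(2)[of "(\<alpha>, \<beta>)" x] x by simp
  qed
  then obtain \<alpha> \<beta> where ab: "\<alpha> \<in> I" "\<beta> \<in> I" and step: "\<And>F. finite F \<Longrightarrow> \<exists>x\<in>D. P \<alpha> \<beta> x F"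
    by auto
  have abL: "\<alpha> \<in> L" "\<beta> \<in> L" using ab IL by auto
  \<comment> \<open>Both coordinates are recorded, so that \<open>d n\<close> and
    \<open>d' n\<close> avoid all earlier values of either sequence and the ranges of
    \<open>d\<close> and \<open>d'\<close> become disjoint.\<close>
  define U where "U x = dpart (rep (x \<alpha>)) \<union> dpart (rep (x \<beta>))" for x :: "'m \<Rightarrow> 'f set"
  have finU: "finite (U x)" if "x \<in> D" for x
    using rep(1) DG[OF that] abL by (simp add: U_def finite_dpart)
  obtain x :: "nat \<Rightarrow> 'm \<Rightarrow> 'f set" where x0: "\<forall>n. x n \<in> D \<and> P \<alpha> \<beta> (x n) (\<Union>m<n. U (x m))"
    using sequence_avoiding_predecessors[where R = "P \<alpha> \<beta>" and F = U, OF step finU] ..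
  have xD: "x n \<in> D" for n using x0 by simp
  have "\<exists>d d'. d \<in> dpart (rep (x n \<alpha>)) - (\<Union>m<n. U (x m)) \<and> d' \<in> dpart (rep (x n \<beta>)) - (\<Union>m<n. U (x m)) \<and> d \<noteq> d'" for n
    using x0[THEN spec, of n] unfolding P_def by blast
  then obtain d d' where d0: "\<And>n. d n \<in> dpart (rep (x n \<alpha>)) - (\<Union>m<n. U (x m)) \<and>
      d' n \<in> dpart (rep (x n \<beta>)) - (\<Union>m<n. U (x m)) \<and> d n \<noteq> d' n"
    by metis
  have d: "d n \<in> dpart (rep (x n \<alpha>))" "d' n \<in> dpart (rep (x n \<beta>))" "d n \<noteq> d' n"
    "m < n \<Longrightarrow> d n \<notin> U (x m)" "m < n \<Longrightarrow> d' n \<notin> U (x m)" for m n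
    using d0[of n] by auto
  have "\<exists>i. (Inl (d n), i) \<in> rep (x n \<alpha>)" "\<exists>i. (Inl (d' n), i) \<in> rep (x n \<beta>)" for n
    using d(1,2)[of n] by (auto simp: dpart_def)
  then obtain i i' where i: "\<And>n. (Inl (d n), i n) \<in> rep (x n \<alpha>)" "\<And>n. (Inl (d' n), i' n) \<in> rep (x n \<beta>)"
    by metis
  have dU: "d n \<in> U (x n)" "d' n \<in> U (x n)" for n using d(1,2)[of n] by (auto simp: U_def)
  have inj_x: "inj x"
  proof (rule injI)
    fix m n assume "x m = x n"
    then show "m = n" using d(4)[of m n] d(4)[of n m] dU(1)[of m] dU(1)[of n]
      by (cases m n rule: linorder_cases) auto
  qed
  have "range x \<subseteq> D" using xD by blast
  from seq[OF inj_x this] obtain Q y where Q: "free_filter Q"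
    and y: "\<forall>\<alpha>\<in>L. y \<alpha> \<in> Gset \<and> conv Q (\<lambda>n. rep (x n \<alpha>)) (rep (y \<alpha>))"
    by (elim exE conjE)
  have ya: "y \<alpha> \<in> Gset" "conv Q (\<lambda>n. rep (x n \<alpha>)) (rep (y \<alpha>))"
    and yb: "y \<beta> \<in> Gset" "conv Q (\<lambda>n. rep (x n \<beta>)) (rep (y \<beta>))" using y abL by auto
  have lim: "finite ((\<Union>n. rep (x n \<gamma>)) \<inter> limits)" if "\<gamma> \<in> L" for \<gamma>
  proof (rule finite_subset[OF _ rel_compact_limits[OF Y[OF that]]])
    show "(\<Union>n. rep (x n \<gamma>)) \<inter> limits \<subseteq> \<Union>(Y \<gamma>) \<inter> limits" using xD by (auto simp: Y_def)
  qed
  show False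
  proof (rule not_conv_two_point_sequences[OF Q ya(2) yb(2)])
    show "d n \<notin> dpart (rep (x m \<alpha>))" if "m < n" for m n using d(4)[OF that] by (simp add: U_def)
    show "d' n \<notin> dpart (rep (x m \<beta>))" if "m < n" for m n using d(5)[OF that] by (simp add: U_def)
    show "d m \<noteq> d' n" for m n
      using d(3)[of n] d(4)[of n m] d(5)[of m n] dU(1)[of m] dU(2)[of n]
      by (cases m n rule: linorder_cases) auto
  qed (use i rep DG[OF xD abL(1)] DG[OF xD abL(2)] ya(1) yb(1) lim[OF abL(1)] lim[OF abL(2)] in simp_all)
qed

end

section \<open>A separating independent family\<close>

lemma ex_inj_nat_times_real: "\<exists>f :: nat \<times> real \<Rightarrow> real. inj f"
proof -
  have "(card_of (UNIV :: nat set), card_of (UNIV :: real set)) \<in> ordLeq"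
    using infinite_UNIV_char_0[where 'a = real] by (simp only: infinite_iff_card_of_nat)
  then have "(card_of ((UNIV :: nat set) \<times> (UNIV :: real set)), card_of (UNIV :: real set)) \<in> ordIso"
    by (intro card_of_Times_infinite_simps(3)) (simp_all add: infinite_UNIV_char_0)
  then obtain f where "bij_betw f ((UNIV :: nat set) \<times> (UNIV :: real set)) (UNIV :: real set)"
    using card_of_ordIso by blast
  then show ?thesis by (auto simp: bij_betw_def)
qed

text \<open>A sequence of sets of reals is a subset of \<open>nat \<times> real\<close>, hence
  codable as a set of reals: \<open>2^c\<close> raised to a countable power is
  \<open>2^c\<close>.\<close>

lemma ex_inj_sequences:
  assumes "inj (f :: 'a \<Rightarrow> real set)"
  shows "\<exists>g :: (nat \<Rightarrow> 'a) \<Rightarrow> real set. inj g"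
proof -
  obtain e :: "nat \<times> real \<Rightarrow> real" where e: "inj e" using ex_inj_nat_times_real by blast
  have "inj (\<lambda>u. e ` (SIGMA n : UNIV. f (u n)))"
  proof (rule injI, rule ext)
    fix u v n assume "e ` (SIGMA n : UNIV. f (u n)) = e ` (SIGMA n : UNIV. f (v n))"
    then have "(SIGMA n : UNIV. f (u n)) = (SIGMA n : UNIV. f (v n))"
      using e by (simp add: inj_image_eq_iff)
    then have "f (u n) = f (v n)" by (auto simp: set_eq_iff)
    then show "u n = v n" using assms by (simp add: inj_eq)
  qed
  then show ?thesis by blast
qed

lemma ex_inj_Pair:
  assumes "inj (f :: 'a \<Rightarrow> real set)" "inj (g :: 'b \<Rightarrow> real set)"
  shows "\<exists>h :: 'a \<times> 'b \<Rightarrow> real set. inj h"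
proof -
  obtain e :: "(nat \<Rightarrow> real set) \<Rightarrow> real set" where e: "inj e"
    using ex_inj_sequences[of "\<lambda>x. x"] by auto
  have "inj (\<lambda>(a, b). e (\<lambda>n. if n = 0 then f a else g b))"
  proof (rule injI, clarify)
    fix a b a' b' assume "e (\<lambda>n. if n = 0 then f a else g b) = e (\<lambda>n. if n = 0 then f a' else g b')"
    then have "(\<lambda>n :: nat. if n = 0 then f a else g b) = (\<lambda>n. if n = 0 then f a' else g b')"
      by (rule injD[OF e])
    from fun_cong[OF this, of 0] fun_cong[OF this, of 1] show "a = a' \<and> b = b'" using assms by (simp add: inj_eq)
  qed
  then show ?thesis by blast
qed

lemma ex_inj_lists:
  assumes "inj (f :: 'a \<Rightarrow> real set)"
  shows "\<exists>h :: 'a list \<Rightarrow> real set. inj h"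
proof -
  obtain g :: "(nat \<Rightarrow> 'a) \<Rightarrow> real set" where g: "inj g" using ex_inj_sequences[OF assms] by blast
  have "inj (\<lambda>n :: nat. {real n})" by (auto simp: inj_def)
  then obtain h :: "nat \<times> (nat \<Rightarrow> 'a) \<Rightarrow> real set" where h: "inj h" using ex_inj_Pair g by blast
  \<comment> \<open>The length is stored as well, because \<open>undefined\<close> may also occur as
    an entry.\<close>
  have "inj (\<lambda>xs. h (length xs, \<lambda>n. if n < length xs then xs ! n else undefined))"
  proof (rule injI)
    fix xs ys assume "h (length xs, \<lambda>n. if n < length xs then xs ! n else undefined) =
      h (length ys, \<lambda>n. if n < length ys then ys ! n else undefined)"
    from injD[OF h this] have "length xs = length ys \<and>
      (\<lambda>n. if n < length xs then xs ! n else undefined) = (\<lambda>n. if n < length ys then ys ! n else undefined)"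
      by (rule iffD1[OF prod.inject])
    note len = conjunct1[OF this] and eq = conjunct2[OF this]
    have "xs ! n = ys ! n" if "n < length xs" for n
      using fun_cong[OF eq, of n] that len by simp
    then show "xs = ys" using len by (intro nth_equalityI)
  qed
  then show ?thesis by blast
qed

text \<open>A character is coded by \<open>(u, B)\<close>: on the countable set \<open>range u\<close> it is the indicator of \<open>u ` B\<close>.
  Off that set, its value at \<open>(d, i)\<close> is read off the finite condition that is coded by \<open>d\<close>; since
  each condition has uncountably many codes, one of them avoids any given countable set.\<close>

lemma ex_separating_independent_family:
  "\<exists>(val :: real set set \<Rightarrow> (real set \<times> real set) set) \<Phi>.
    (\<forall>S V. countable S \<longrightarrow> (\<exists>\<phi>\<in>\<Phi>. val \<phi> \<inter> S = V \<inter> S)) \<and>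
    (\<forall>C C'. finite C \<longrightarrow> C \<subseteq> \<Phi> \<times> UNIV \<longrightarrow> (\<exists>d. \<forall>(\<phi>, i)\<in>C. (d, i) \<in> val \<phi> \<longleftrightarrow> (\<phi>, i) \<in> C'))"
proof -
  have id: "inj (\<lambda>x :: real set. x)" by simp
  have "\<exists>f :: real set \<times> real set \<Rightarrow> real set. inj f" by (rule ex_inj_Pair[OF id id])
  then have seq: "\<exists>f :: (nat \<Rightarrow> real set \<times> real set) \<Rightarrow> real set. inj f" using ex_inj_sequences by blast
  have "inj (\<lambda>B :: nat set. real ` B)" by (auto simp: inj_def inj_image_eq_iff)
  then have "\<exists>f :: (nat \<Rightarrow> real set \<times> real set) \<times> nat set \<Rightarrow> real set. inj f"
    using seq ex_inj_Pair by blast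
  then obtain code :: "(nat \<Rightarrow> real set \<times> real set) \<times> nat set \<Rightarrow> real set" where code: "inj code" by blast
  have "\<exists>f :: (((nat \<Rightarrow> real set \<times> real set) \<times> nat set) \<times> real set) list \<Rightarrow> real set. inj f"
    using ex_inj_Pair[OF code id] ex_inj_lists by blast
  moreover have "inj (\<lambda>r :: real. {r})" by simp
  ultimately have "\<exists>f :: (((nat \<Rightarrow> real set \<times> real set) \<times> nat set) \<times> real set) list \<times> real \<Rightarrow> real set. inj f"
    using ex_inj_Pair by blast
  then obtain e :: "(((nat \<Rightarrow> real set \<times> real set) \<times> nat set) \<times> real set) list \<times> real \<Rightarrow> real set"
    where e: "inj e" by blast
  \<comment> \<open>A code consists of a list and a real; the real gives each list uncountably many
    codes.\<close>
  define cond where "cond d = set (fst (inv_into UNIV e d))" for d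
  have cond: "cond (e (xs, r)) = set xs" for xs r by (simp add: cond_def inv_f_f[OF e])
  define val0 where "val0 \<psi> = fst \<psi> ` snd \<psi> \<union> {(d, i). (d, i) \<notin> range (fst \<psi>) \<and> (\<psi>, i) \<in> cond d}" for \<psi>
  \<comment> \<open>The singleton moves the code into the index type
    \<open>real set set\<close>.\<close>
  define h where "h \<psi> = {code \<psi>}" for \<psi>
  have h: "inj h" using code by (auto simp: h_def inj_def)
  define val where "val \<phi> = val0 (inv_into UNIV h \<phi>)" for \<phi>
  have val: "val (h \<psi>) = val0 \<psi>" for \<psi> by (simp add: val_def inv_f_f[OF h])
  have "\<exists>\<phi>\<in>range h. val \<phi> \<inter> S = V \<inter> S" if S: "countable S" for S V
  proof -
    \<comment> \<open>Inserting \<open>undefined\<close> makes the enumerated set nonempty.\<close>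
    define u where "u = from_nat_into (insert undefined S)"
    have u: "range u = insert undefined S"
      unfolding u_def using S by (intro range_from_nat_into) auto
    have "val0 (u, u -` V) \<inter> S = V \<inter> S"
    proof (rule Set.set_eqI)
      fix x
      show "x \<in> val0 (u, u -` V) \<inter> S \<longleftrightarrow> x \<in> V \<inter> S"
      proof (cases "x \<in> S")
        case True
        then obtain n where n: "x = u n" using u by (metis insertI2 rangeE)
        then have "x \<in> range u" by simp
        then have "x \<in> val0 (u, u -` V) \<longleftrightarrow> x \<in> u ` (u -` V)" by (cases x) (simp add: val0_def)
        also have "\<dots> \<longleftrightarrow> x \<in> V" using n by auto
        finally show ?thesis by simp
      qed simp
    qed
    then show ?thesis by (intro bexI[of _ "h (u, u -` V)"]) (simp_all add: val)
  qed
  moreover have "\<exists>d. \<forall>(\<phi>, i)\<in>C. (d, i) \<in> val \<phi> \<longleftrightarrow> (\<phi>, i) \<in> C'" if C: "finite C" "C \<subseteq> range h \<times> UNIV" for C C'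
  proof -
    have "inj (\<lambda>(\<psi>, i :: real set). (h \<psi>, i))" using h by (auto simp: inj_def)
    then have "finite ((\<lambda>(\<psi>, i). (h \<psi>, i)) -` (C \<inter> C'))" using C(1) by (intro finite_vimageI) auto
    \<comment> \<open>The condition to be coded: the pairs of \<open>C\<close> at which the value
      has to be 1.\<close>
    then obtain xs where xs: "set xs = (\<lambda>(\<psi>, i). (h \<psi>, i)) -` (C \<inter> C')" using finite_list by blast
    \<comment> \<open>First coordinates at which some character of \<open>C\<close> may follow its
      countable part instead of the coded condition.\<close>
    define bad where "bad = (\<Union>c\<in>C. fst ` range (fst (inv_into UNIV h (fst c))))"
    have "countable bad"
      unfolding bad_def using C(1) by (intro countable_UN countable_image countableI_type) (auto intro: countable_finite)
    moreover have "uncountable (range (\<lambda>r. e (xs, r)))"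
    proof
      assume "countable (range (\<lambda>r. e (xs, r)))"
      moreover have "inj (\<lambda>r. e (xs, r))" using e by (auto simp: inj_def)
      ultimately have "countable (UNIV :: real set)" by (simp add: countable_image_inj_eq)
      then show False using uncountable_UNIV_real by simp
    qed
    ultimately have "\<not> range (\<lambda>r. e (xs, r)) \<subseteq> bad" using countable_subset by blast
    then obtain r where r: "e (xs, r) \<notin> bad" by blast
    have "(e (xs, r), i) \<in> val \<phi> \<longleftrightarrow> (\<phi>, i) \<in> C'" if c: "(\<phi>, i) \<in> C" for \<phi> i
    proof -
      obtain \<psi> where \<psi>: "\<phi> = h \<psi>" using C(2) c by auto
      have "fst ` range (fst (inv_into UNIV h (fst (\<phi>, i)))) \<subseteq> bad"
        unfolding bad_def using c by (rule UN_upper)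
      then have sub: "fst ` range (fst \<psi>) \<subseteq> bad" by (simp add: \<psi> inv_f_f[OF h])
      have new: "(e (xs, r), i) \<notin> range (fst \<psi>)"
      proof
        assume "(e (xs, r), i) \<in> range (fst \<psi>)"
        then have "fst (e (xs, r), i) \<in> fst ` range (fst \<psi>)" by (rule imageI)
        then have "fst (e (xs, r), i) \<in> bad" using sub by (rule subsetD[rotated])
        then show False using r by simp
      qed
      then have "(e (xs, r), i) \<notin> fst \<psi> ` snd \<psi>" by blast
      then have "(e (xs, r), i) \<in> val \<phi> \<longleftrightarrow> (\<psi>, i) \<in> set xs"
        using new by (simp add: \<psi> val val0_def cond)
      also have "\<dots> \<longleftrightarrow> (\<phi>, i) \<in> C'" using c by (simp add: xs \<psi>)
      finally show ?thesis .
    qed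
    then show ?thesis by (intro exI[of _ "e (xs, r)"]) auto
  qed
  ultimately show ?thesis by (intro exI[of _ val] exI[of _ "range h"]) simp
qed

section \<open>Instantiating the construction\<close>

theorem mainTheorem13:
  fixes K :: "real set set"
  assumes "\<exists>P :: nat set set set. (card_of P, card_of (UNIV :: real set set)) \<in> ordIso \<and>
              (\<forall>p\<in>P. selective_ultrafilter p) \<and>
              (\<forall>p\<in>P. \<forall>q\<in>P. p \<noteq> q \<longrightarrow> RK_incomparable p q)"
    and "infinite K"
    and "(card_of K, card_of (UNIV :: real set set)) \<in> ordLeq"
  shows "\<exists>(G :: real set set set monoid) T.
           topological_group G T \<and> Hausdorff_space T \<and>
           countably_pracompact (product_topology (\<lambda>_. T) K) \<and>
           (\<forall>K' :: real set set set. (card_of K', cardSuc (card_of K)) \<in> ordIso \<longrightarrow>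
              \<not> countably_pracompact (product_topology (\<lambda>_. T) K'))"
proof -
  obtain P :: "nat set set set" where P: "(card_of P, card_of (UNIV :: real set set)) \<in> ordIso"
    "\<forall>p\<in>P. selective_ultrafilter p"
    "\<forall>p\<in>P. \<forall>q\<in>P. p \<noteq> q \<longrightarrow> RK_incomparable p q"
    using assms(1) by (elim exE conjE)
  obtain b where b: "bij_betw b (UNIV :: real set set) P"
    using iffD2[OF card_of_ordIso ordIso_symmetric[OF P(1)]] ..
  \<comment> \<open>With \<open>real set\<close> as the set of first coordinates there are only
    \<open>2^c\<close> sequences, so distinct sequences can get distinct ultrafilters.\<close>
  obtain g :: "(nat \<Rightarrow> real set) \<Rightarrow> real set" where g: "inj g"
    using ex_inj_sequences[of "\<lambda>x. x"] by auto
  define p where "p s = b (g s)" for s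
  have pP: "p s \<in> P" for s using b by (auto simp: p_def bij_betw_def)
  have p_inj: "s = t" if "p s = p t" for s t
    using b g that by (auto simp: p_def bij_betw_def inj_def)
  obtain val :: "real set set \<Rightarrow> (real set \<times> real set) set" and \<Phi> where
    sep: "\<forall>S V. countable S \<longrightarrow> (\<exists>\<phi>\<in>\<Phi>. val \<phi> \<inter> S = V \<inter> S)" and
    indep: "\<forall>C C'. finite C \<longrightarrow> C \<subseteq> \<Phi> \<times> UNIV \<longrightarrow> (\<exists>d. \<forall>(\<phi>, i)\<in>C. (d, i) \<in> val \<phi> \<longleftrightarrow> (\<phi>, i) \<in> C')"
    using ex_separating_independent_family by (elim exE conjE)
  interpret ultrafilter_group p val \<Phi> K
  proof
    have sel: "selective_ultrafilter (p s)" for s using P(2) pP by (rule bspec)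
    show "free_ultrafilter (p s)" for s
      using sel[of s] by (simp add: selective_ultrafilter_def)
    show "\<exists>U\<in>p s. \<forall>n. finite (U - W n)" if "\<And>n. W n \<in> p s" for W :: "nat \<Rightarrow> nat set" and s
      by (rule selective_pseudo_intersection[where W = W, OF sel that])
    \<comment> \<open>Distinct members of \<open>P\<close> are incomparable, and the assignment
      \<open>p\<close> is injective.\<close>
    show "s = t" if "RK_le (p s) (p t)" for s t
      using P(3)[THEN bspec, OF pP[of s], THEN bspec, OF pP[of t]] p_inj[of s t] that
      unfolding RK_incomparable_def by blast
    show "\<exists>\<phi>\<in>\<Phi>. val \<phi> \<inter> S = V \<inter> S" if "countable S" for S V
      using sep that by simp
    show "\<exists>d. \<forall>(\<phi>, i)\<in>C. (d, i) \<in> val \<phi> \<longleftrightarrow> (\<phi>, i) \<in> C'" if "finite C" "C \<subseteq> \<Phi> \<times> UNIV" for C C'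
      using indep that by simp
  qed
  have "infinite (UNIV :: real set set)"
  proof
    assume "finite (UNIV :: real set set)"
    then have "finite (UNIV :: real set)" by (simp add: Finite_Set.finite_set)
    then show False using infinite_UNIV_char_0 by blast
  qed
  from not_countably_pracompact_power[OF this assms(2)] show ?thesis
    by (intro exI[of _ G] exI[of _ T] conjI allI impI
        topological_group_G Hausdorff_T countably_pracompact_power)
qed

end
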